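(* Consider the one-dimensional two-velocity two-fluid system with added mass $$(\alpha^\pm\rho^\pm)_t+(\alpha^\pm\rho^\pm u^\pm)_x=0,$$ $$(\alpha^\pm\rho^\pm u^\pm)_t+\left(\alpha^\pm(\rho^\pm (u^\pm)^2+p)\right)_x=p\,\alpha^\pm_x+f^\pm,$$ $$(\alpha^\pm\rho^\pm E^\pm)_t+\left(\alpha^\pm(\rho^\pm E^\pm+p)u^\pm\right)_x+p\,\alpha^\pm_t=f^\pm u^\pm,$$ $$f^\pm=\mp\kappa\,\frac{\alpha^+\alpha^-\rho^+\rho^-}{\alpha^+\rho^++\alpha^-\rho^-}\,\frac{\partial(u^+-u^-)}{\partial t},\qquad \kappa\ge 0 .$$ Linearize it around a constant state of rest ($u^+=u^-=0$) with $\alpha^\pm\in(0,1)$ and $\rho^\pm>0$. Then the set of eigenvalues of the linearized system is $\{-c_\kappa,\,0,\,c_\kappa\}$, where $c_\kappa>0$ is given by $$c_\kappa^2=\left(\alpha^+\frac{\rho+\kappa\rho^+}{\rho(1+\kappa)\rho^+}+\alpha^-\frac{\rho+\kappa\rho^-}{\rho(1+\kappa)\rho^-}\right)\frac{\rho^+\rho^-(c^+)^2(c^-)^2}{\alpha^+\rho^-(c^-)^2+\alpha^-\rho^+(c^+)^2},\qquad \rho=\alpha^+\rho^++\alpha^-\rho^- .$$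
   Context: The two fluids are labelled $+$ and $-$; $\alpha^\pm$ are volume fractions with $\alpha^++\alpha^-=1$, $\rho^\pm$ densities, $u^\pm$ velocities, $s^\pm$ specific entropies, $p$ the common pressure, $E^\pm=e^\pm+\tfrac12(u^\pm)^2$ with $e^\pm$ the specific internal energy. Each fluid has a smooth equation of state $e^\pm=e^\pm(\rho^\pm,s^\pm)$ with temperature $T^\pm=\partial e^\pm/\partial s^\pm>0$, pressure $p=P^\pm(\rho^\pm,s^\pm)=(\rho^\pm)^2\,\partial e^\pm/\partial\rho^\pm$, and $(c^\pm)^2=\partial P^\pm/\partial\rho^\pm|_{s^\pm}>0$, $c^\pm>0$. The six unknowns are $(\alpha^+,p,u^+,u^-,s^+,s^-)$, the densities being functions of $(p,s^\pm)$ through the equations of state. The coefficient $\kappa\ge0$ may be a function of $p,s^\pm,\alpha^\pm$. Linearizing around a constant state (keeping first-order terms in the perturbation) gives a constant-coefficient system $M\,\partial_tW+N\,\partial_xW=0$ with $M$ invertible; its eigenvalues are the eigenvalues of $M^{-1}N$. In the formula all quantities, including $\kappa$, are evaluated at the constant state. *)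

theory Defs
  imports "HOL-Analysis.Derivative" "Jordan_Normal_Form.Spectral_Radius"
begin

text \<open>
  Functions of two real variables are functions on pairs. The pair is \<open>(\<rho>, s)\<close> for
  equations of state, \<open>(p, s)\<close> for densities, and \<open>(t, x)\<close> for fields; in the last case
  \<open>pd1\<close> is the time derivative and \<open>pd2\<close> the space derivative.
\<close>

definition pd1 :: "(real \<times> real \<Rightarrow> real) \<Rightarrow> real \<times> real \<Rightarrow> real" where
  "pd1 f z = deriv (\<lambda>a. f (a, snd z)) (fst z)"

definition pd2 :: "(real \<times> real \<Rightarrow> real) \<Rightarrow> real \<times> real \<Rightarrow> real" where
  "pd2 f z = deriv (\<lambda>b. f (fst z, b)) (snd z)"

fun Ck_on :: "nat \<Rightarrow> (real \<times> real) set \<Rightarrow> (real \<times> real \<Rightarrow> real) \<Rightarrow> bool" where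
  "Ck_on 0 D f \<longleftrightarrow> continuous_on D f"
| "Ck_on (Suc k) D f \<longleftrightarrow> f differentiable_on D \<and> Ck_on k D (pd1 f) \<and> Ck_on k D (pd2 f)"

text \<open>Intended for open sets only.\<close>

definition smooth_on :: "(real \<times> real) set \<Rightarrow> (real \<times> real \<Rightarrow> real) \<Rightarrow> bool" where
  "smooth_on D f \<longleftrightarrow> (\<forall>k. Ck_on k D f)"


definition temperature :: "(real \<times> real \<Rightarrow> real) \<Rightarrow> real \<times> real \<Rightarrow> real" where
  "temperature e = pd2 e"

definition pressure :: "(real \<times> real \<Rightarrow> real) \<Rightarrow> real \<times> real \<Rightarrow> real" where
  "pressure e z = (fst z)\<^sup>2 * pd1 e z"

definition sound_speed_sq :: "(real \<times> real \<Rightarrow> real) \<Rightarrow> real \<times> real \<Rightarrow> real" where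
  "sound_speed_sq e = pd1 (pressure e)"

text \<open>The domain \<open>D\<close> of the equation of state is an arbitrary open set of pairs \<open>(\<rho>, s)\<close>.\<close>

definition equation_of_state :: "(real \<times> real) set \<Rightarrow> (real \<times> real \<Rightarrow> real) \<Rightarrow> bool" where
  "equation_of_state D e \<longleftrightarrow> open D \<and> smooth_on D e \<and>
     (\<forall>z\<in>D. temperature e z > 0 \<and> sound_speed_sq e z > 0)"

text \<open>
  \<open>R\<close> expresses the density through \<open>(p, s)\<close> on the open set \<open>Q\<close>. On a non-convex domain
  \<open>D\<close> the equation \<open>P(\<rho>, s) = p\<close> may have several solutions; continuity fixes a branch, which
  is then smooth because \<open>\<partial>P/\<partial>\<rho> > 0\<close>.
\<close>

definition density_law ::
  "(real \<times> real) set \<Rightarrow> (real \<times> real \<Rightarrow> real) \<Rightarrow> (real \<times> real) set \<Rightarrow> (real \<times> real \<Rightarrow> real) \<Rightarrow> bool"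
where
  "density_law D e Q R \<longleftrightarrow> open Q \<and> continuous_on Q R \<and>
     (\<forall>p s. (p, s) \<in> Q \<longrightarrow> (R (p, s), s) \<in> D \<and> pressure e (R (p, s), s) = p)"


text \<open>
  Residuals (left-hand side minus right-hand side) of the balance laws of a single fluid, for
  scalar fields of \<open>(t, x)\<close>; \<open>f\<close> is the interaction force.
\<close>

definition mass_residual ::
  "(real \<times> real \<Rightarrow> real) \<Rightarrow> (real \<times> real \<Rightarrow> real) \<Rightarrow> (real \<times> real \<Rightarrow> real) \<Rightarrow> real \<times> real \<Rightarrow> real"
where
  "mass_residual \<alpha> \<rho> u z = pd1 (\<lambda>y. \<alpha> y * \<rho> y) z + pd2 (\<lambda>y. \<alpha> y * \<rho> y * u y) z"

definition momentum_residual ::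
  "(real \<times> real \<Rightarrow> real) \<Rightarrow> (real \<times> real \<Rightarrow> real) \<Rightarrow> (real \<times> real \<Rightarrow> real) \<Rightarrow> (real \<times> real \<Rightarrow> real) \<Rightarrow>
   (real \<times> real \<Rightarrow> real) \<Rightarrow> real \<times> real \<Rightarrow> real"
where
  "momentum_residual \<alpha> \<rho> u p f z =
     pd1 (\<lambda>y. \<alpha> y * \<rho> y * u y) z + pd2 (\<lambda>y. \<alpha> y * (\<rho> y * (u y)\<^sup>2 + p y)) z
     - (p z * pd2 \<alpha> z + f z)"

definition energy_residual ::
  "(real \<times> real \<Rightarrow> real) \<Rightarrow> (real \<times> real \<Rightarrow> real) \<Rightarrow> (real \<times> real \<Rightarrow> real) \<Rightarrow> (real \<times> real \<Rightarrow> real) \<Rightarrow>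
   (real \<times> real \<Rightarrow> real) \<Rightarrow> (real \<times> real \<Rightarrow> real) \<Rightarrow> real \<times> real \<Rightarrow> real"
where
  "energy_residual \<alpha> \<rho> u p E f z =
     pd1 (\<lambda>y. \<alpha> y * \<rho> y * E y) z + pd2 (\<lambda>y. \<alpha> y * (\<rho> y * E y + p y) * u y) z
     + p z * pd1 \<alpha> z - f z * u z"

text \<open>
  The unknown is \<open>W = (\<alpha>\<^sup>+, p, u\<^sup>+, u\<^sup>-, s\<^sup>+, s\<^sup>-)\<close>; the suffixes \<open>p\<close> and \<open>m\<close> stand for the
  fluids \<open>+\<close> and \<open>-\<close>. As \<open>\<alpha>\<^sup>- = 1 - \<alpha>\<^sup>+\<close>, the coefficient \<open>\<kappa>\<close> is a function of
  \<open>(p, s\<^sup>+, s\<^sup>-, \<alpha>\<^sup>+)\<close>.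
\<close>

definition two_fluid_residual ::
  "(real \<times> real \<Rightarrow> real) \<Rightarrow> (real \<times> real \<Rightarrow> real) \<Rightarrow> (real \<times> real \<Rightarrow> real) \<Rightarrow> (real \<times> real \<Rightarrow> real) \<Rightarrow>
   (real \<times> real \<times> real \<times> real \<Rightarrow> real) \<Rightarrow> (real \<times> real \<Rightarrow> real vec) \<Rightarrow> real \<times> real \<Rightarrow> real vec"
where
  "two_fluid_residual ep em Rp Rm \<kappa> W z =
    (let \<alpha>p = (\<lambda>y. W y $ 0); \<alpha>m = (\<lambda>y. 1 - W y $ 0);
         p = (\<lambda>y. W y $ 1);
         up = (\<lambda>y. W y $ 2); um = (\<lambda>y. W y $ 3);
         sp = (\<lambda>y. W y $ 4); sm = (\<lambda>y. W y $ 5);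
         \<rho>p = (\<lambda>y. Rp (p y, sp y)); \<rho>m = (\<lambda>y. Rm (p y, sm y));
         Ep = (\<lambda>y. ep (\<rho>p y, sp y) + (up y)\<^sup>2 / 2);
         Em = (\<lambda>y. em (\<rho>m y, sm y) + (um y)\<^sup>2 / 2);
         g = (\<lambda>y. \<kappa> (p y, sp y, sm y, \<alpha>p y)
                    * (\<alpha>p y * \<alpha>m y * \<rho>p y * \<rho>m y / (\<alpha>p y * \<rho>p y + \<alpha>m y * \<rho>m y))
                    * pd1 (\<lambda>y'. up y' - um y') y);
         fp = (\<lambda>y. - g y); fm = g
     in vec_of_list
          [mass_residual \<alpha>p \<rho>p up z, mass_residual \<alpha>m \<rho>m um z,
           momentum_residual \<alpha>p \<rho>p up p fp z, momentum_residual \<alpha>m \<rho>m um p fm z,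
           energy_residual \<alpha>p \<rho>p up p Ep fp z, energy_residual \<alpha>m \<rho>m um p Em fm z])"


definition smooth_field :: "nat \<Rightarrow> (real \<times> real \<Rightarrow> real vec) \<Rightarrow> bool" where
  "smooth_field n w \<longleftrightarrow> (\<forall>z. w z \<in> carrier_vec n) \<and> (\<forall>i<n. smooth_on UNIV (\<lambda>z. w z $ i))"

text \<open>
  \<open>M W\<^sub>t + N W\<^sub>x = 0\<close> is the linearization at the constant state \<open>W0\<close> of the system
  \<open>F W = 0\<close> if \<open>M w\<^sub>t + N w\<^sub>x\<close> is the first-order term of \<open>F (W0 + \<epsilon> w)\<close> in \<open>\<epsilon>\<close>,
  for every perturbation \<open>w\<close>.
\<close>

definition is_linearization ::
  "nat \<Rightarrow> ((real \<times> real \<Rightarrow> real vec) \<Rightarrow> real \<times> real \<Rightarrow> real vec) \<Rightarrow> real vec \<Rightarrow>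
   real mat \<Rightarrow> real mat \<Rightarrow> bool"
where
  "is_linearization n F W0 M N \<longleftrightarrow> M \<in> carrier_mat n n \<and> N \<in> carrier_mat n n \<and>
     (\<forall>w. smooth_field n w \<longrightarrow> (\<forall>z. \<forall>i<n.
        ((\<lambda>\<epsilon>. F (\<lambda>y. W0 + \<epsilon> \<cdot>\<^sub>v w y) z $ i) has_real_derivative
           (M *\<^sub>v vec n (\<lambda>j. pd1 (\<lambda>y. w y $ j) z) + N *\<^sub>v vec n (\<lambda>j. pd2 (\<lambda>y. w y $ j) z)) $ i)
        (at 0)))"

end

theory Submission
  imports Defs
begin

text \<open>
  The perturbed residuals are built from families of fields whose partial derivatives vanish at
  \<open>\<epsilon> = 0\<close>, so their first-order terms follow from the product and chain rules once the densities
  are known to be \<open>C\<^sup>1\<close> functions of \<open>(p, s)\<close> with \<open>\<partial>\<rho>/\<partial>p = 1 / c\<^sup>2\<close>. In the linearized system,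
  subtracting the enthalpy times the mass balance from the energy balance leaves
  \<open>\<alpha> \<rho> T \<partial>\<^sub>t s = 0\<close>. For an eigenvalue \<open>l \<noteq> 0\<close> the entropy perturbations therefore vanish, and
  elimination of \<open>\<alpha>\<^sup>+\<close> and of the velocities leaves one scalar equation
  \<open>(l\<^sup>2 - c\<^sub>\<kappa>\<^sup>2) q = 0\<close> for the pressure perturbation \<open>q\<close>; a perturbation of \<open>\<alpha>\<^sup>+\<close> alone
  gives the eigenvalue \<open>0\<close>.
\<close>

no_notation vec_nth (infixl "$" 90)

subsection \<open>Partial derivatives\<close>

text \<open>Openness is built in so that \<open>differentiable_on\<close> yields a derivative at
  each point of \<open>S\<close>, and so that arguments close to a point of \<open>S\<close> stay in
  \<open>S\<close>.\<close>

definition C1_on :: "(real \<times> real) set \<Rightarrow> (real \<times> real \<Rightarrow> real) \<Rightarrow> bool" where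
  "C1_on S f \<longleftrightarrow> open S \<and> f differentiable_on S \<and> continuous_on S (pd1 f) \<and> continuous_on S (pd2 f)"

lemma has_derivative_slices:
  assumes "(f has_derivative (\<lambda>h. a * fst h + b * snd h)) (at z)"
  shows "((\<lambda>t. f (t, snd z)) has_real_derivative a) (at (fst z))"
    and "((\<lambda>x. f (fst z, x)) has_real_derivative b) (at (snd z))"
proof -
  have f: "(f has_derivative (\<lambda>h. a * fst h + b * snd h)) (at (fst z, snd z))"
    using assms by simp
  have "((\<lambda>t. f (t, snd z)) has_derivative (\<lambda>h. a * fst (h, 0::real) + b * snd (h, 0::real))) (at (fst z))"
    by (rule has_derivative_compose[of "\<lambda>t. (t, snd z)" "\<lambda>h. (h, 0)" _ UNIV, OF _ f])
      (auto intro!: derivative_eq_intros)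
  then show "((\<lambda>t. f (t, snd z)) has_real_derivative a) (at (fst z))"
    by (simp add: has_field_derivative_def)
  have "((\<lambda>x. f (fst z, x)) has_derivative (\<lambda>h. a * fst (0::real, h) + b * snd (0::real, h))) (at (snd z))"
    by (rule has_derivative_compose[of "\<lambda>x. (fst z, x)" "\<lambda>h. (0, h)" _ UNIV, OF _ f])
      (auto intro!: derivative_eq_intros)
  then show "((\<lambda>x. f (fst z, x)) has_real_derivative b) (at (snd z))"
    by (simp add: has_field_derivative_def)
qed

lemma pd_eq:
  assumes "(f has_derivative (\<lambda>h. a * fst h + b * snd h)) (at z)"
  shows "pd1 f z = a" "pd2 f z = b"
  unfolding pd1_def pd2_def by (rule DERIV_imp_deriv has_derivative_slices[OF assms])+

lemma differentiable_has_derivative_pd: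
  fixes f :: "real \<times> real \<Rightarrow> real"
  assumes "f differentiable (at z)"
  shows "(f has_derivative (\<lambda>h. pd1 f z * fst h + pd2 f z * snd h)) (at z)"
proof -
  from assms obtain L where L: "(f has_derivative L) (at z)"
    by (auto simp: differentiable_def)
  interpret L: linear L
    using L by (rule has_derivative_linear)
  have "L h = L (1, 0) * fst h + L (0, 1) * snd h" for h
  proof -
    have "h = fst h *\<^sub>R (1, 0) + snd h *\<^sub>R (0, 1)"
      by (simp add: prod_eq_iff)
    then have "L h = fst h *\<^sub>R L (1, 0) + snd h *\<^sub>R L (0, 1)"
      by (metis L.add L.scale)
    then show ?thesis
      by simp
  qed
  then have "L = (\<lambda>h. L (1, 0) * fst h + L (0, 1) * snd h)"
    by (rule ext)
  with L have "(f has_derivative (\<lambda>h. L (1, 0) * fst h + L (0, 1) * snd h)) (at z)"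
    by simp
  with pd_eq[OF this] show ?thesis
    by simp
qed

lemma C1_on_has_derivative:
  assumes "C1_on S f" "z \<in> S"
  shows "(f has_derivative (\<lambda>h. pd1 f z * fst h + pd2 f z * snd h)) (at z)"
  using assms by (intro differentiable_has_derivative_pd)
    (auto simp: C1_on_def differentiable_on_eq_differentiable_at)

lemma C1_onI:
  assumes "open S" "continuous_on S a" "continuous_on S b"
    and "\<And>z. z \<in> S \<Longrightarrow> (f has_derivative (\<lambda>h. a z * fst h + b z * snd h)) (at z)"
  shows "C1_on S f"
proof -
  have "f differentiable_on S"
    using assms(1,4) by (auto simp: differentiable_on_eq_differentiable_at differentiable_def)
  moreover have "continuous_on S (pd1 f)" "continuous_on S (pd2 f)"
    using assms pd_eq[OF assms(4)] by (simp_all cong: continuous_on_cong)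
  ultimately show ?thesis
    using assms by (simp add: C1_on_def)
qed

lemma smooth_on_imp_C1_on:
  assumes "smooth_on S f" "open S"
  shows "C1_on S f"
proof -
  have "Ck_on (Suc 0) S f"
    using assms by (auto simp: smooth_on_def)
  then show ?thesis
    using assms by (simp add: C1_on_def)
qed

lemma smooth_on_pd1: "smooth_on S f \<Longrightarrow> smooth_on S (pd1 f)"
  unfolding smooth_on_def by (metis Ck_on.simps(2))

lemma Ck_on_const: "Ck_on k S (\<lambda>_. c)"
proof (induction k arbitrary: c)
  case (Suc k)
  have "pd1 (\<lambda>_. c) = (\<lambda>_. 0)" "pd2 (\<lambda>_. c) = (\<lambda>_. 0)"
    by (auto simp: pd1_def pd2_def)
  with Suc show ?case
    by simp
qed auto

lemma pd_affine:
  shows "pd1 (\<lambda>z. a * fst z + b * snd z) = (\<lambda>_. a)" "pd2 (\<lambda>z. a * fst z + b * snd z) = (\<lambda>_. b)"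
  by (auto intro!: pd_eq derivative_eq_intros)

text \<open>Linear fields serve as test perturbations in \<open>is_linearization_unique\<close>:
  their partial derivatives are constants that can be prescribed freely.\<close>

lemma smooth_on_linear: "smooth_on UNIV (\<lambda>z. a * fst z + b * snd z)"
proof -
  have "Ck_on k UNIV (\<lambda>z. a * fst z + b * snd z)" for k
    by (cases k)
      (auto simp: pd_affine Ck_on_const intro!: continuous_intros derivative_intros
        bounded_linear_imp_differentiable_on bounded_linear_add bounded_linear_const_mult
        bounded_linear_fst bounded_linear_snd)
  then show ?thesis
    by (simp add: smooth_on_def)
qed


subsection \<open>First-order expansions\<close>

text \<open>
  The derivative in \<open>t\<close> is only required for \<open>\<epsilon>\<close> near 0, and no joint smoothness in \<open>(\<epsilon>, t)\<close> is
  asked for. The clause \<open>A 0 = 0\<close> (constant state at \<open>\<epsilon> = 0\<close>) makes products with factors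
  that are merely continuous in \<open>\<epsilon>\<close> differentiable at 0.
\<close>

definition curve_expansion :: "(real \<Rightarrow> real \<Rightarrow> real) \<Rightarrow> real \<Rightarrow> real \<Rightarrow> real \<Rightarrow> bool" where
  "curve_expansion \<psi> t c a \<longleftrightarrow> \<psi> 0 t = c \<and> isCont (\<lambda>\<epsilon>. \<psi> \<epsilon> t) 0 \<and>
     (\<exists>A. (\<forall>\<^sub>F \<epsilon> in nhds 0. (\<psi> \<epsilon> has_real_derivative A \<epsilon>) (at t)) \<and>
          A 0 = 0 \<and> (A has_real_derivative a) (at 0))"

text \<open>Only the two slices through \<open>z\<close> enter, since \<open>pd1\<close> and
  \<open>pd2\<close> are slice derivatives. Here \<open>c\<close> is the value at the constant
  state, while \<open>a\<close> and \<open>b\<close> are the \<epsilon>-derivatives at 0 of the time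
  and space derivatives of the field.\<close>

definition expansion ::
  "(real \<Rightarrow> real \<times> real \<Rightarrow> real) \<Rightarrow> real \<times> real \<Rightarrow> real \<Rightarrow> real \<Rightarrow> real \<Rightarrow> bool"
where
  "expansion \<phi> z c a b \<longleftrightarrow> curve_expansion (\<lambda>\<epsilon> t. \<phi> \<epsilon> (t, snd z)) (fst z) c a \<and>
     curve_expansion (\<lambda>\<epsilon> x. \<phi> \<epsilon> (fst z, x)) (snd z) c b"

lemma curve_expansionE:
  assumes "curve_expansion \<psi> t c a"
  obtains A where "\<forall>\<^sub>F \<epsilon> in nhds 0. (\<psi> \<epsilon> has_real_derivative A \<epsilon>) (at t)"
    "A 0 = 0" "(A has_real_derivative a) (at 0)"
  using assms unfolding curve_expansion_def by blast

text \<open>Because \<open>f x = 0\<close>, the slope function of the product is that of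
  \<open>f\<close> times \<open>g\<close>, and this is continuous at \<open>x\<close> as soon as
  \<open>g\<close> is. Factors such as \<kappa> and the first derivatives of an equation of state
  are handled in this way.\<close>

lemma DERIV_mult_isCont:
  fixes f g :: "real \<Rightarrow> real"
  assumes "(f has_real_derivative a) (at x)" "f x = 0" "isCont g x"
  shows "((\<lambda>y. f y * g y) has_real_derivative a * g x) (at x)"
proof -
  from assms(1) obtain q where q: "\<And>y. f y - f x = q y * (y - x)" "isCont q x" "q x = a"
    by (auto simp: CARAT_DERIV)
  have "f y = q y * (y - x)" for y
    using q(1)[of y] assms(2) by simp
  then show ?thesis
    unfolding CARAT_DERIV
    by (intro exI[of _ "\<lambda>y. q y * g y"]) (use q assms in \<open>auto intro!: isCont_mult\<close>)
qed

lemma curve_expansion_const: "curve_expansion (\<lambda>\<epsilon> t. c) t c 0"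
  unfolding curve_expansion_def by (auto intro!: exI[of _ "\<lambda>_. 0"])

lemma curve_expansion_affine:
  assumes "(w has_real_derivative a) (at t)"
  shows "curve_expansion (\<lambda>\<epsilon> t. c + \<epsilon> * w t) t c a"
  unfolding curve_expansion_def
  by (intro conjI exI[of _ "\<lambda>\<epsilon>. \<epsilon> * a"] always_eventually allI)
    (use assms in \<open>auto intro!: derivative_eq_intros continuous_intros\<close>)

lemma curve_expansion_add:
  assumes "curve_expansion \<phi> t c a" "curve_expansion \<psi> t d b"
  shows "curve_expansion (\<lambda>\<epsilon> t. \<phi> \<epsilon> t + \<psi> \<epsilon> t) t (c + d) (a + b)"
proof -
  from curve_expansionE[OF assms(1)] obtain A where A:
    "\<forall>\<^sub>F \<epsilon> in nhds 0. (\<phi> \<epsilon> has_real_derivative A \<epsilon>) (at t)" "A 0 = 0" "(A has_real_derivative a) (at 0)" .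
  from curve_expansionE[OF assms(2)] obtain B where B:
    "\<forall>\<^sub>F \<epsilon> in nhds 0. (\<psi> \<epsilon> has_real_derivative B \<epsilon>) (at t)" "B 0 = 0" "(B has_real_derivative b) (at 0)" .
  have "\<forall>\<^sub>F \<epsilon> in nhds 0. ((\<lambda>t. \<phi> \<epsilon> t + \<psi> \<epsilon> t) has_real_derivative A \<epsilon> + B \<epsilon>) (at t)"
    using A(1) B(1) by eventually_elim (rule DERIV_add)
  moreover have "((\<lambda>\<epsilon>. A \<epsilon> + B \<epsilon>) has_real_derivative a + b) (at 0)"
    using A(3) B(3) by (rule DERIV_add)
  ultimately show ?thesis
    using A B assms unfolding curve_expansion_def
    by (intro conjI exI[of _ "\<lambda>\<epsilon>. A \<epsilon> + B \<epsilon>"]) (auto intro!: isCont_add)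
qed

text \<open>Each term of the product rule in \<open>t\<close> is a derivative vanishing at
  \<epsilon> = 0 times a factor continuous in \<epsilon>, which is the situation of
  \<open>DERIV_mult_isCont\<close>.\<close>

lemma curve_expansion_mult:
  assumes "curve_expansion \<phi> t c a" "curve_expansion \<psi> t d b"
  shows "curve_expansion (\<lambda>\<epsilon> t. \<phi> \<epsilon> t * \<psi> \<epsilon> t) t (c * d) (a * d + b * c)"
proof -
  from curve_expansionE[OF assms(1)] obtain A where A:
    "\<forall>\<^sub>F \<epsilon> in nhds 0. (\<phi> \<epsilon> has_real_derivative A \<epsilon>) (at t)" "A 0 = 0" "(A has_real_derivative a) (at 0)" .
  from curve_expansionE[OF assms(2)] obtain B where B:
    "\<forall>\<^sub>F \<epsilon> in nhds 0. (\<psi> \<epsilon> has_real_derivative B \<epsilon>) (at t)" "B 0 = 0" "(B has_real_derivative b) (at 0)" .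
  have "((\<lambda>\<epsilon>. A \<epsilon> * \<psi> \<epsilon> t + B \<epsilon> * \<phi> \<epsilon> t) has_real_derivative a * \<psi> 0 t + b * \<phi> 0 t) (at 0)"
    using A B assms unfolding curve_expansion_def by (intro DERIV_add DERIV_mult_isCont) auto
  moreover have "\<forall>\<^sub>F \<epsilon> in nhds 0. ((\<lambda>t. \<phi> \<epsilon> t * \<psi> \<epsilon> t) has_real_derivative
      A \<epsilon> * \<psi> \<epsilon> t + B \<epsilon> * \<phi> \<epsilon> t) (at t)"
    using A(1) B(1) by eventually_elim (rule DERIV_mult)
  ultimately show ?thesis
    using A B assms unfolding curve_expansion_def
    by (intro conjI exI[of _ "\<lambda>\<epsilon>. A \<epsilon> * \<psi> \<epsilon> t + B \<epsilon> * \<phi> \<epsilon> t"])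
      (auto intro!: isCont_mult)
qed

text \<open>In the chain rule \<open>A\<close> and \<open>B\<close> vanish at \<epsilon> = 0 and the
  partial derivatives of \<open>f\<close> are continuous, so \<open>DERIV_mult_isCont\<close>
  applies to both terms and second derivatives of \<open>f\<close> never appear.\<close>

lemma curve_expansion_compose:
  assumes f: "C1_on S f" "(c, d) \<in> S"
    and \<phi>: "curve_expansion \<phi> t c a" and \<psi>: "curve_expansion \<psi> t d b"
  shows "curve_expansion (\<lambda>\<epsilon> t. f (\<phi> \<epsilon> t, \<psi> \<epsilon> t)) t (f (c, d)) (a * pd1 f (c, d) + b * pd2 f (c, d))"
proof -
  from curve_expansionE[OF \<phi>] obtain A where A:
    "\<forall>\<^sub>F \<epsilon> in nhds 0. (\<phi> \<epsilon> has_real_derivative A \<epsilon>) (at t)" "A 0 = 0" "(A has_real_derivative a) (at 0)" .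
  from curve_expansionE[OF \<psi>] obtain B where B:
    "\<forall>\<^sub>F \<epsilon> in nhds 0. (\<psi> \<epsilon> has_real_derivative B \<epsilon>) (at t)" "B 0 = 0" "(B has_real_derivative b) (at 0)" .
  let ?g = "\<lambda>\<epsilon>. (\<phi> \<epsilon> t, \<psi> \<epsilon> t)"
  have g: "isCont ?g 0" "?g 0 = (c, d)"
    using \<phi> \<psi> by (auto simp: curve_expansion_def intro!: continuous_intros)
  have "open S"
    using f by (simp add: C1_on_def)
  have cont: "isCont f (c, d)" "isCont (pd1 f) (c, d)" "isCont (pd2 f) (c, d)"
    using f C1_on_has_derivative[OF f] unfolding C1_on_def
    by (auto simp: continuous_on_eq_continuous_at intro: has_derivative_continuous)
  have comp: "isCont (\<lambda>\<epsilon>. F (?g \<epsilon>)) 0" if "isCont F (c, d)" for F :: "real \<times> real \<Rightarrow> real"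
    using isCont_o2[OF g(1), of F] that g(2) by simp
  \<comment> \<open>Since \<open>S\<close> is open, the arguments of \<open>f\<close> lie in
    \<open>S\<close> for all small \<epsilon>, and the chain rule is available there.\<close>
  have "(?g \<longlongrightarrow> ?g 0) (nhds 0)"
    using g(1) unfolding isCont_def by (rule iffD1[OF tendsto_at_iff_tendsto_nhds])
  then have "(?g \<longlongrightarrow> (c, d)) (nhds 0)"
    unfolding g(2) .
  then have S: "\<forall>\<^sub>F \<epsilon> in nhds 0. ?g \<epsilon> \<in> S"
    using \<open>open S\<close> f(2) by (rule topological_tendstoD)
  have "\<forall>\<^sub>F \<epsilon> in nhds 0. ((\<lambda>t. f (\<phi> \<epsilon> t, \<psi> \<epsilon> t)) has_real_derivative
      A \<epsilon> * pd1 f (?g \<epsilon>) + B \<epsilon> * pd2 f (?g \<epsilon>)) (at t)"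
    using A(1) B(1) S
  proof eventually_elim
    case (elim \<epsilon>)
    have "((\<lambda>t. (\<phi> \<epsilon> t, \<psi> \<epsilon> t)) has_derivative (\<lambda>h. (A \<epsilon> * h, B \<epsilon> * h))) (at t)"
      using elim(1,2) by (intro has_derivative_Pair) (simp_all add: has_field_derivative_def)
    from has_derivative_compose[OF this C1_on_has_derivative[OF f(1) elim(3)]]
    show ?case
      unfolding has_field_derivative_def
      by (rule has_derivative_eq_rhs) (simp add: fun_eq_iff algebra_simps)
  qed
  moreover have "((\<lambda>\<epsilon>. A \<epsilon> * pd1 f (?g \<epsilon>) + B \<epsilon> * pd2 f (?g \<epsilon>)) has_real_derivative
      a * pd1 f (?g 0) + b * pd2 f (?g 0)) (at 0)"
    using A B cont by (intro DERIV_add DERIV_mult_isCont comp) auto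
  ultimately show ?thesis
    using A B comp[OF cont(1)] g(2) unfolding curve_expansion_def
    by (intro conjI exI[of _ "\<lambda>\<epsilon>. A \<epsilon> * pd1 f (?g \<epsilon>) + B \<epsilon> * pd2 f (?g \<epsilon>)"]) auto
qed

text \<open>The derivatives exist for all \<epsilon> in a neighbourhood that contains 0 itself, so
  \<open>deriv\<close> agrees with \<open>A\<close> both near 0 and at 0.\<close>

lemma curve_expansion_deriv:
  assumes "curve_expansion \<psi> t c a"
  shows "((\<lambda>\<epsilon>. deriv (\<psi> \<epsilon>) t) has_real_derivative a) (at 0)" "deriv (\<psi> 0) t = 0"
proof -
  from curve_expansionE[OF assms] obtain A where A:
    "\<forall>\<^sub>F \<epsilon> in nhds 0. (\<psi> \<epsilon> has_real_derivative A \<epsilon>) (at t)" "A 0 = 0" "(A has_real_derivative a) (at 0)" .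
  have ev: "\<forall>\<^sub>F \<epsilon> in nhds 0. deriv (\<psi> \<epsilon>) t = A \<epsilon>"
    using A(1) by eventually_elim (rule DERIV_imp_deriv)
  show "((\<lambda>\<epsilon>. deriv (\<psi> \<epsilon>) t) has_real_derivative a) (at 0)"
    using A(3) by (rule iffD2[OF DERIV_cong_ev[OF refl ev refl]])
  from ev A(2) show "deriv (\<psi> 0) t = 0"
    by (auto dest: eventually_nhds_x_imp_x)
qed

lemma expansion_const: "expansion (\<lambda>\<epsilon> y. c) z c 0 0"
  by (simp add: expansion_def curve_expansion_const)

lemma expansion_affine:
  assumes "w differentiable (at z)"
  shows "expansion (\<lambda>\<epsilon> y. c + \<epsilon> * w y) z c (pd1 w z) (pd2 w z)"
  unfolding expansion_def
  by (intro conjI curve_expansion_affine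
      has_derivative_slices[OF differentiable_has_derivative_pd[OF assms]])

lemma expansion_add:
  assumes "expansion \<phi> z c a b" "expansion \<psi> z c' a' b'"
  shows "expansion (\<lambda>\<epsilon> y. \<phi> \<epsilon> y + \<psi> \<epsilon> y) z (c + c') (a + a') (b + b')"
  using assms unfolding expansion_def by (auto intro: curve_expansion_add)

lemma expansion_mult:
  assumes "expansion \<phi> z c a b" "expansion \<psi> z c' a' b'"
  shows "expansion (\<lambda>\<epsilon> y. \<phi> \<epsilon> y * \<psi> \<epsilon> y) z (c * c') (a * c' + a' * c) (b * c' + b' * c)"
  using assms unfolding expansion_def by (auto intro: curve_expansion_mult)

lemma expansion_diff:
  assumes "expansion \<phi> z c a b" "expansion \<psi> z c' a' b'"
  shows "expansion (\<lambda>\<epsilon> y. \<phi> \<epsilon> y - \<psi> \<epsilon> y) z (c - c') (a - a') (b - b')"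
  using expansion_add[OF assms(1) expansion_mult[OF expansion_const[of "-1"] assms(2)]] by simp

lemma expansion_compose:
  assumes "C1_on S f" "(c, c') \<in> S" "expansion \<phi> z c a b" "expansion \<psi> z c' a' b'"
  shows "expansion (\<lambda>\<epsilon> y. f (\<phi> \<epsilon> y, \<psi> \<epsilon> y)) z (f (c, c'))
           (a * pd1 f (c, c') + a' * pd2 f (c, c')) (b * pd1 f (c, c') + b' * pd2 f (c, c'))"
  using assms unfolding expansion_def by (auto intro: curve_expansion_compose)

lemma expansion_isCont:
  assumes "expansion \<phi> z c a b"
  shows "isCont (\<lambda>\<epsilon>. \<phi> \<epsilon> z) 0" "\<phi> 0 z = c"
  using assms by (auto simp: expansion_def curve_expansion_def)

lemma expansion_pd:
  assumes "expansion \<phi> z c a b"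
  shows "((\<lambda>\<epsilon>. pd1 (\<phi> \<epsilon>) z) has_real_derivative a) (at 0)" "pd1 (\<phi> 0) z = 0"
    and "((\<lambda>\<epsilon>. pd2 (\<phi> \<epsilon>) z) has_real_derivative b) (at 0)" "pd2 (\<phi> 0) z = 0"
  using assms unfolding expansion_def pd1_def pd2_def by (auto dest: curve_expansion_deriv)


subsection \<open>Densities\<close>

lemma pressure_C1_on:
  assumes "equation_of_state D e"
  shows "C1_on D (pressure e)"
proof -
  have op: "open D" and "smooth_on D e"
    using assms by (auto simp: equation_of_state_def)
  then have f: "C1_on D (pd1 e)"
    by (intro smooth_on_imp_C1_on smooth_on_pd1)
  have "continuous_on D (pd1 e)" "continuous_on D (pd1 (pd1 e))" "continuous_on D (pd2 (pd1 e))"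
    using f by (auto simp: C1_on_def differentiable_imp_continuous_on)
  then show ?thesis
    using op C1_on_has_derivative[OF f] unfolding pressure_def
    by (intro C1_onI[of _ "\<lambda>z. 2 * fst z * pd1 e z + (fst z)\<^sup>2 * pd1 (pd1 e) z" "\<lambda>z. (fst z)\<^sup>2 * pd2 (pd1 e) z"])
      (auto intro!: continuous_intros derivative_eq_intros simp: algebra_simps)
qed

text \<open>Differentiability of the continuous branch \<open>R\<close> comes from the derivative
  rule for inverses, applied after adjoining the coordinate \<open>s\<close>. The derivative of
  (\<rho>, s) \<mapsto> (P, s) is triangular with diagonal entries \<open>sound_speed_sq\<close> and
  1, hence invertible.\<close>

lemma density_law_derivative:
  assumes e: "equation_of_state D e" and R: "density_law D e Q R" and z: "z \<in> Q"
  defines "x \<equiv> (R z, snd z)"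
  shows "(R has_derivative (\<lambda>h. 1 / sound_speed_sq e x * fst h
           + (- (pd2 (pressure e) x / sound_speed_sq e x)) * snd h)) (at z)"
proof -
  let ?c = "sound_speed_sq e x" and ?b = "pd2 (pressure e) x"
  let ?H = "\<lambda>y. (R y, snd y)" and ?G = "\<lambda>y. (pressure e y, snd y)"
  have Q: "open Q" "continuous_on Q R"
    and D: "\<And>y. y \<in> Q \<Longrightarrow> (R y, snd y) \<in> D \<and> pressure e (R y, snd y) = fst y"
    using R by (auto simp: density_law_def)
  have x: "x \<in> D"
    using D z by (simp add: x_def)
  have c: "?c > 0"
    using e x by (auto simp: equation_of_state_def)
  have P: "(pressure e has_derivative (\<lambda>h. ?c * fst h + ?b * snd h)) (at (?H z))"
    using C1_on_has_derivative[OF pressure_C1_on[OF e] x] by (simp add: sound_speed_sq_def x_def)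
  \<comment> \<open>\<open>(p, s) \<mapsto> (R (p, s), s)\<close> is a continuous right inverse of \<open>(\<rho>, s) \<mapsto> (P (\<rho>, s), s)\<close>.\<close>
  have "(?H has_derivative (\<lambda>h. (1 / ?c * fst h + (- (?b / ?c)) * snd h, snd h))) (at z)"
  proof (rule has_derivative_inverse_basic[of ?G "\<lambda>h. (?c * fst h + ?b * snd h, snd h)" ?H z _ Q])
    show "(?G has_derivative (\<lambda>h. (?c * fst h + ?b * snd h, snd h))) (at (?H z))"
      by (auto intro!: derivative_eq_intros P)
    show "bounded_linear (\<lambda>h. (1 / ?c * fst h + (- (?b / ?c)) * snd h, snd h))"
      by (intro bounded_linear_Pair bounded_linear_add bounded_linear_const_mult
          bounded_linear_fst bounded_linear_snd)
    show "continuous (at z) ?H"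
      using Q z by (auto intro!: continuous_intros simp: continuous_on_eq_continuous_at)
  qed (use c Q D z in \<open>auto simp: fun_eq_iff field_simps\<close>)
  from has_derivative_fst[OF this] show ?thesis
    by simp
qed

text \<open>The partial derivatives just computed are continuous functions on \<open>D\<close>
  evaluated along the continuous map (p, s) \<mapsto> (R (p, s), s), with a positive
  denominator.\<close>

lemma density_law_C1_on:
  assumes e: "equation_of_state D e" and R: "density_law D e Q R"
  shows "C1_on Q R"
proof (rule C1_onI)
  let ?H = "\<lambda>y. (R y, snd y)"
  have Q: "open Q" "continuous_on Q R" "?H ` Q \<subseteq> D"
    using R by (auto simp: density_law_def)
  then have H: "continuous_on Q ?H"
    by (auto intro!: continuous_intros)
  have P: "continuous_on D (sound_speed_sq e)" "continuous_on D (pd2 (pressure e))"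
    using pressure_C1_on[OF e] by (auto simp: C1_on_def sound_speed_sq_def)
  have pos: "\<forall>z\<in>Q. sound_speed_sq e (?H z) > 0"
    using e Q by (auto simp: equation_of_state_def)
  note comp = continuous_on_compose2[OF P(1) H Q(3)] continuous_on_compose2[OF P(2) H Q(3)]
  show "open Q" by fact
  show "continuous_on Q (\<lambda>z. 1 / sound_speed_sq e (?H z))"
    using comp pos by (auto intro!: continuous_intros)
  show "continuous_on Q (\<lambda>z. - (pd2 (pressure e) (?H z) / sound_speed_sq e (?H z)))"
    using comp pos by (auto intro!: continuous_intros)
qed (rule density_law_derivative[OF assms])


subsection \<open>Linearization of the balance laws\<close>

lemma mass_residual_derivative:
  assumes \<alpha>: "expansion \<alpha> z a a1 a2" and \<rho>: "expansion \<rho> z r r1 r2" and u: "expansion u z 0 u1 u2"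
  shows "((\<lambda>\<epsilon>. mass_residual (\<alpha> \<epsilon>) (\<rho> \<epsilon>) (u \<epsilon>) z) has_real_derivative
           a1 * r + a * r1 + a * r * u2) (at 0)"
proof -
  note \<alpha>\<rho> = expansion_mult[OF \<alpha> \<rho>]
  show ?thesis
    unfolding mass_residual_def
    using DERIV_add[OF expansion_pd(1)[OF \<alpha>\<rho>] expansion_pd(3)[OF expansion_mult[OF \<alpha>\<rho> u]]]
    by (simp add: algebra_simps)
qed

text \<open>The convective term is of third order in the perturbation of rest up to its coefficient
  \<open>a * r\<close>, so only its vanishing first-order part matters; the part
  \<open>a2 * p0\<close> of the pressure flux cancels against the nozzling term
  \<open>p * pd2 \<alpha>\<close>.\<close>

lemma momentum_residual_derivative:
  assumes \<alpha>: "expansion \<alpha> z a a1 a2" and \<rho>: "expansion \<rho> z r r1 r2" and u: "expansion u z 0 u1 u2"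
    and p: "expansion p z p0 p1 p2" and f: "((\<lambda>\<epsilon>. f \<epsilon> z) has_real_derivative f') (at 0)"
  shows "((\<lambda>\<epsilon>. momentum_residual (\<alpha> \<epsilon>) (\<rho> \<epsilon>) (u \<epsilon>) (p \<epsilon>) (f \<epsilon>) z) has_real_derivative
           a * r * u1 + a * p2 - f') (at 0)"
proof -
  have "((\<lambda>\<epsilon>. pd2 (\<alpha> \<epsilon>) z * p \<epsilon> z) has_real_derivative a2 * p 0 z) (at 0)"
    by (intro DERIV_mult_isCont expansion_pd[OF \<alpha>] expansion_isCont[OF p])
  then have "((\<lambda>\<epsilon>. p \<epsilon> z * pd2 (\<alpha> \<epsilon>) z) has_real_derivative a2 * p0) (at 0)"
    by (simp add: mult.commute expansion_isCont[OF p])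
  note force = DERIV_add[OF this f]
  have u2: "expansion (\<lambda>\<epsilon> y. (u \<epsilon> y)\<^sup>2) z 0 0 0"
    using expansion_mult[OF u u] by (simp add: power2_eq_square)
  note expansion_mult[OF \<alpha> expansion_add[OF expansion_mult[OF \<rho> u2] p]]
  from DERIV_diff[OF DERIV_add[OF expansion_pd(1)[OF expansion_mult[OF expansion_mult[OF \<alpha> \<rho>] u]]
      expansion_pd(3)[OF this]] force]
  show ?thesis
    unfolding momentum_residual_def by (simp add: algebra_simps)
qed

text \<open>At rest both the force and the velocity vanish, so the power \<open>f * u\<close> of the
  force has no first-order term.\<close>

lemma energy_residual_derivative:
  assumes \<alpha>: "expansion \<alpha> z a a1 a2" and \<rho>: "expansion \<rho> z r r1 r2" and u: "expansion u z 0 u1 u2"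
    and p: "expansion p z p0 p1 p2" and E: "expansion E z e e1 e2"
    and f: "((\<lambda>\<epsilon>. f \<epsilon> z) has_real_derivative f') (at 0)" "f 0 z = 0"
  shows "((\<lambda>\<epsilon>. energy_residual (\<alpha> \<epsilon>) (\<rho> \<epsilon>) (u \<epsilon>) (p \<epsilon>) (E \<epsilon>) (f \<epsilon>) z) has_real_derivative
           (a1 * r + a * r1) * e + a * r * e1 + a * (r * e + p0) * u2 + p0 * a1) (at 0)"
proof -
  have "((\<lambda>\<epsilon>. pd1 (\<alpha> \<epsilon>) z * p \<epsilon> z) has_real_derivative a1 * p 0 z) (at 0)"
    by (intro DERIV_mult_isCont expansion_pd[OF \<alpha>] expansion_isCont[OF p])
  then have work: "((\<lambda>\<epsilon>. p \<epsilon> z * pd1 (\<alpha> \<epsilon>) z) has_real_derivative a1 * p0) (at 0)"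
    by (simp add: mult.commute expansion_isCont[OF p])
  have "((\<lambda>\<epsilon>. f \<epsilon> z * u \<epsilon> z) has_real_derivative f' * u 0 z) (at 0)"
    by (intro DERIV_mult_isCont f expansion_isCont[OF u])
  then have force: "((\<lambda>\<epsilon>. f \<epsilon> z * u \<epsilon> z) has_real_derivative 0) (at 0)"
    by (simp add: expansion_isCont[OF u])
  note \<alpha>\<rho> = expansion_mult[OF \<alpha> \<rho>]
  note expansion_mult[OF expansion_mult[OF \<alpha> expansion_add[OF expansion_mult[OF \<rho> E] p]] u]
  from DERIV_diff[OF DERIV_add[OF DERIV_add[OF expansion_pd(1)[OF expansion_mult[OF \<alpha>\<rho> E]]
      expansion_pd(3)[OF this]] work] force]
  show ?thesis
    unfolding energy_residual_def by (simp add: algebra_simps)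
qed

text \<open>The energy balance is put in the form of the enthalpy \<open>e + p0 / r\<close> times
  the linearized mass balance \<open>m\<close> plus an entropy term. This is the shape that
  decouples the entropies in the eigenvalue problem.\<close>

lemma fluid_derivatives:
  assumes e: "equation_of_state D e" and R: "density_law D e Q R" and Q: "(p0, s0) \<in> Q"
    and r: "r = R (p0, s0)" "r \<noteq> 0"
    and \<alpha>: "expansion \<alpha> z a a1 a2" and p: "expansion p z p0 p1 p2" and u: "expansion u z 0 u1 u2"
    and s: "expansion s z s0 s1 s2"
  defines "\<rho> \<equiv> \<lambda>\<epsilon> y. R (p \<epsilon> y, s \<epsilon> y)"
    and "m \<equiv> a1 * r + a * (p1 / sound_speed_sq e (r, s0) + s1 * pd2 R (p0, s0)) + a * r * u2"
  shows "((\<lambda>\<epsilon>. mass_residual (\<alpha> \<epsilon>) (\<rho> \<epsilon>) (u \<epsilon>) z) has_real_derivative m) (at 0)"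
    and "((\<lambda>\<epsilon>. f \<epsilon> z) has_real_derivative f') (at 0) \<Longrightarrow>
      ((\<lambda>\<epsilon>. momentum_residual (\<alpha> \<epsilon>) (\<rho> \<epsilon>) (u \<epsilon>) (p \<epsilon>) (f \<epsilon>) z) has_real_derivative
         a * r * u1 + a * p2 - f') (at 0)"
    and "((\<lambda>\<epsilon>. f \<epsilon> z) has_real_derivative f') (at 0) \<Longrightarrow> f 0 z = 0 \<Longrightarrow>
      ((\<lambda>\<epsilon>. energy_residual (\<alpha> \<epsilon>) (\<rho> \<epsilon>) (u \<epsilon>) (p \<epsilon>)
         (\<lambda>y. e (\<rho> \<epsilon> y, s \<epsilon> y) + (u \<epsilon> y)\<^sup>2 / 2) (f \<epsilon>) z) has_real_derivative
         (e (r, s0) + p0 / r) * m + a * r * temperature e (r, s0) * s1) (at 0)"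
    and "expansion \<rho> z r (p1 / sound_speed_sq e (r, s0) + s1 * pd2 R (p0, s0))
           (p2 / sound_speed_sq e (r, s0) + s2 * pd2 R (p0, s0))"
proof -
  let ?c = "sound_speed_sq e (r, s0)" and ?d = "pd2 R (p0, s0)"
  have "pd1 R (p0, s0) = 1 / ?c"
    using pd_eq(1)[OF density_law_derivative[OF e R Q]] r by simp
  with expansion_compose[OF density_law_C1_on[OF e R] Q p s]
  show \<rho>: "expansion \<rho> z r (p1 / ?c + s1 * ?d) (p2 / ?c + s2 * ?d)"
    by (simp add: \<rho>_def r)
  have D: "(r, s0) \<in> D" "pressure e (r, s0) = p0"
    using R Q r by (auto simp: density_law_def)
  have "C1_on D e"
    using e by (auto simp: equation_of_state_def intro: smooth_on_imp_C1_on)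
  from expansion_compose[OF this D(1) \<rho> s] have
    e': "expansion (\<lambda>\<epsilon> y. e (\<rho> \<epsilon> y, s \<epsilon> y)) z (e (r, s0))
      ((p1 / ?c + s1 * ?d) * pd1 e (r, s0) + s1 * pd2 e (r, s0))
      ((p2 / ?c + s2 * ?d) * pd1 e (r, s0) + s2 * pd2 e (r, s0))" .
  have u2: "expansion (\<lambda>\<epsilon> y. (u \<epsilon> y)\<^sup>2 / 2) z 0 0 0"
    using expansion_mult[OF expansion_const[of "1/2"] expansion_mult[OF u u]]
    by (simp add: power2_eq_square)
  note E = expansion_add[OF e' u2]
  have pd1: "pd1 e (r, s0) = p0 / r / r"
    using D(2) r(2) by (simp add: pressure_def power2_eq_square field_simps)
  show "((\<lambda>\<epsilon>. mass_residual (\<alpha> \<epsilon>) (\<rho> \<epsilon>) (u \<epsilon>) z) has_real_derivative m) (at 0)"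
    using mass_residual_derivative[OF \<alpha> \<rho> u] by (simp add: m_def)
  {
    assume f: "((\<lambda>\<epsilon>. f \<epsilon> z) has_real_derivative f') (at 0)"
    show "((\<lambda>\<epsilon>. momentum_residual (\<alpha> \<epsilon>) (\<rho> \<epsilon>) (u \<epsilon>) (p \<epsilon>) (f \<epsilon>) z) has_real_derivative
         a * r * u1 + a * p2 - f') (at 0)"
      by (rule momentum_residual_derivative[where f = f, OF \<alpha> \<rho> u p f])
    assume f0: "f 0 z = 0"
    \<comment> \<open>The three terms with \<open>p0\<close>, which stem from the density derivative
      of \<open>e\<close>, from the pressure flux and from the work term
      \<open>p * pd1 \<alpha>\<close>, add up to \<open>p0 / r\<close> times the mass
      balance.\<close>
    have eq: "(a1 * r + a * r1) * e0 + a * r * (r1 * (p0 / r / r) + s1 * T) + a * (r * e0 + p0) * u2 + p0 * a1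
      = (e0 + p0 / r) * (a1 * r + a * r1 + a * r * u2) + a * r * T * s1" for r1 e0 T
      using r(2) by (simp add: field_simps)
    show "((\<lambda>\<epsilon>. energy_residual (\<alpha> \<epsilon>) (\<rho> \<epsilon>) (u \<epsilon>) (p \<epsilon>)
         (\<lambda>y. e (\<rho> \<epsilon> y, s \<epsilon> y) + (u \<epsilon> y)\<^sup>2 / 2) (f \<epsilon>) z) has_real_derivative
         (e (r, s0) + p0 / r) * m + a * r * temperature e (r, s0) * s1) (at 0)"
      using energy_residual_derivative[where f = f, OF \<alpha> \<rho> u p E f f0]
      unfolding pd1 add_0_right eq m_def temperature_def .
  }
qed


subsection \<open>Uniqueness of the linearization\<close>

text \<open>A perturbation whose only nonzero component is \<open>a * t + b * x\<close> in position
  \<open>j\<close> reads off \<open>a\<close> times column \<open>j\<close> of \<open>M\<close> plus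
  \<open>b\<close> times column \<open>j\<close> of \<open>N\<close>. The choices (1, 0) and (0, 1)
  separate the two matrices.\<close>

lemma is_linearization_unique:
  assumes L: "is_linearization n F W0 M N" "is_linearization n F W0 M' N'"
  shows "M = M'" "N = N'"
proof -
  have MN: "M \<in> carrier_mat n n" "N \<in> carrier_mat n n" "M' \<in> carrier_mat n n" "N' \<in> carrier_mat n n"
    using L by (auto simp: is_linearization_def)
  have eq: "a * M $$ (i, j) + b * N $$ (i, j) = a * M' $$ (i, j) + b * N' $$ (i, j)"
    if ij: "i < n" "j < n" for i j and a b :: real
  proof -
    define w where "w = (\<lambda>z::real\<times>real. vec n (\<lambda>k. (if k = j then a else 0) * fst z + (if k = j then b else 0) * snd z))"
    have wk: "(\<lambda>y. w y $ k) = (\<lambda>z. (if k = j then a else 0) * fst z + (if k = j then b else 0) * snd z)"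
      if "k < n" for k
      using that by (auto simp: w_def)
    have w: "smooth_field n w"
      unfolding smooth_field_def
    proof (intro conjI allI impI)
      fix k assume "k < n"
      then show "smooth_on UNIV (\<lambda>z. w z $ k)"
        by (simp only: wk smooth_on_linear)
    qed (simp add: w_def)
    have "vec n (\<lambda>k. pd1 (\<lambda>y. w y $ k) z) = a \<cdot>\<^sub>v unit_vec n j"
      "vec n (\<lambda>k. pd2 (\<lambda>y. w y $ k) z) = b \<cdot>\<^sub>v unit_vec n j" for z
      using ij by (auto simp: wk pd_affine unit_vec_def)
    with L w ij have "(M *\<^sub>v (a \<cdot>\<^sub>v unit_vec n j) + N *\<^sub>v (b \<cdot>\<^sub>v unit_vec n j)) $ i =
        (M' *\<^sub>v (a \<cdot>\<^sub>v unit_vec n j) + N' *\<^sub>v (b \<cdot>\<^sub>v unit_vec n j)) $ i"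
      unfolding is_linearization_def by (metis (no_types, lifting) DERIV_unique)
    moreover have "(X *\<^sub>v (c \<cdot>\<^sub>v unit_vec n j)) $ i = c * X $$ (i, j)"
      if "X \<in> carrier_mat n n" for X :: "real mat" and c
      using that ij by (simp add: mult_mat_vec[OF that] scalar_prod_right_unit)
    ultimately show ?thesis
      using MN ij by simp
  qed
  show "M = M'"
    using MN eq[of _ _ 1 0] by (intro eq_matI) auto
  show "N = N'"
    using MN eq[of _ _ 0 1] by (intro eq_matI) auto
qed


subsection \<open>Eigenvalues of the linearized system\<close>

text \<open>Multiplying by \<open>M\<close> or by its inverse passes to the pencil equation, so the
  inverse never has to be computed.\<close>

lemma eigenvalue_inverse_mult_iff:
  fixes M N M' :: "'a :: field mat"
  assumes M: "M \<in> carrier_mat n n" and N: "N \<in> carrier_mat n n" and M': "M' \<in> carrier_mat n n"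
    and inv: "M * M' = 1\<^sub>m n" "M' * M = 1\<^sub>m n"
  shows "eigenvalue (M' * N) l \<longleftrightarrow>
    (\<exists>v\<in>carrier_vec n. v \<noteq> 0\<^sub>v n \<and> N *\<^sub>v v = l \<cdot>\<^sub>v (M *\<^sub>v v))"
proof -
  have "(M' * N) *\<^sub>v v = l \<cdot>\<^sub>v v \<longleftrightarrow> N *\<^sub>v v = l \<cdot>\<^sub>v (M *\<^sub>v v)" if v: "v \<in> carrier_vec n" for v
  proof
    assume "(M' * N) *\<^sub>v v = l \<cdot>\<^sub>v v"
    then have "M *\<^sub>v (M' *\<^sub>v (N *\<^sub>v v)) = M *\<^sub>v (l \<cdot>\<^sub>v v)"
      using M' N v by (simp add: assoc_mult_mat_vec)
    moreover have "M *\<^sub>v (M' *\<^sub>v (N *\<^sub>v v)) = N *\<^sub>v v"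
      using M M' N v inv(1) assoc_mult_mat_vec[OF M M', of "N *\<^sub>v v"] by simp
    ultimately show "N *\<^sub>v v = l \<cdot>\<^sub>v (M *\<^sub>v v)"
      using M v by (simp add: mult_mat_vec)
  next
    assume "N *\<^sub>v v = l \<cdot>\<^sub>v (M *\<^sub>v v)"
    then have "(M' * N) *\<^sub>v v = M' *\<^sub>v (l \<cdot>\<^sub>v (M *\<^sub>v v))"
      using M' N v by (simp add: assoc_mult_mat_vec)
    also have "\<dots> = l \<cdot>\<^sub>v ((M' * M) *\<^sub>v v)"
      using M M' v by (simp add: mult_mat_vec assoc_mult_mat_vec)
    finally show "(M' * N) *\<^sub>v v = l \<cdot>\<^sub>v v"
      using inv(2) v by simp
  qed
  then show ?thesis
    using M' unfolding eigenvalue_def eigenvector_def by (simp add: Bex_def cong: conj_cong)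
qed

lemma trivial_kernel_imp_inverse:
  fixes M :: "'a :: field mat"
  assumes M: "M \<in> carrier_mat n n"
    and ker: "\<And>v. v \<in> carrier_vec n \<Longrightarrow> M *\<^sub>v v = 0\<^sub>v n \<Longrightarrow> v = 0\<^sub>v n"
  obtains M' where "M' \<in> carrier_mat n n" "M * M' = 1\<^sub>m n" "M' * M = 1\<^sub>m n"
proof -
  have "det M \<noteq> 0"
    using det_0_iff_vec_prod_zero_field[OF M] ker by blast
  from det_non_zero_imp_unit[OF M this, of "()"] that show ?thesis
    by (auto simp: Units_def ring_mat_def)
qed

section \<open>Six-component vectors and the matrices of the linearized system\<close>

lemma all_less_6: "(\<forall>i<6::nat. P i) \<longleftrightarrow> P 0 \<and> P 1 \<and> P 2 \<and> P 3 \<and> P 4 \<and> P 5"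
  by (auto simp: All_less_Suc eval_nat_numeral)

lemma mult_mat_vec_6:
  assumes "A \<in> carrier_mat 6 6" "v \<in> carrier_vec 6" "i < 6"
  shows "(A *\<^sub>v v) $ i = A $$ (i, 0) * v $ 0 + A $$ (i, 1) * v $ 1 + A $$ (i, 2) * v $ 2
    + A $$ (i, 3) * v $ 3 + A $$ (i, 4) * v $ 4 + A $$ (i, 5) * v $ 5"
proof -
  have sum: "(\<Sum>j = 0..<6::nat. f j) = f 0 + f 1 + f 2 + f 3 + f 4 + f 5" for f :: "nat \<Rightarrow> 'a"
    by (simp add: eval_nat_numeral)
  show ?thesis
    using assms by (simp add: scalar_prod_def sum)
qed

lemma vec_of_list_6_index:
  "vec_of_list [a, b, c, d, e, f] $ 0 = a" "vec_of_list [a, b, c, d, e, f] $ 1 = b"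
  "vec_of_list [a, b, c, d, e, f] $ 2 = c" "vec_of_list [a, b, c, d, e, f] $ 3 = d"
  "vec_of_list [a, b, c, d, e, f] $ 4 = e" "vec_of_list [a, b, c, d, e, f] $ 5 = f"
  by (simp_all add: vec_of_list_index del: vec_of_list_Cons)

lemma vec_6_eq_iff:
  assumes "v \<in> carrier_vec 6" "w \<in> carrier_vec 6"
  shows "v = w \<longleftrightarrow> v $ 0 = w $ 0 \<and> v $ 1 = w $ 1 \<and> v $ 2 = w $ 2 \<and> v $ 3 = w $ 3 \<and> v $ 4 = w $ 4 \<and> v $ 5 = w $ 5"
proof -
  have "v = w \<longleftrightarrow> (\<forall>i<6. v $ i = w $ i)"
    using assms by auto
  then show ?thesis
    unfolding all_less_6 .
qed

text \<open>
  Rows five and six are the energy balances. They contain the enthalpies \<open>h\<^sub>i = e\<^sub>i + p / r\<^sub>i\<close>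
  times the mass balances, because \<open>\<partial>e/\<partial>\<rho> = p / \<rho>\<^sup>2\<close>; what remains is \<open>a\<^sub>i r\<^sub>i T\<^sub>i \<partial>\<^sub>t s\<^sub>i\<close>.
\<close>

definition mass_matrix ::
  "real \<Rightarrow> real \<Rightarrow> real \<Rightarrow> real \<Rightarrow> real \<Rightarrow> real \<Rightarrow> real \<Rightarrow> real \<Rightarrow> real \<Rightarrow> real \<Rightarrow> real \<Rightarrow> real \<Rightarrow> real \<Rightarrow> real mat"
where
  "mass_matrix a1 a2 r1 r2 b1 b2 d1 d2 h1 h2 T1 T2 C = mat 6 6 (\<lambda>(i, j).
     [[r1, a1 * b1, 0, 0, a1 * d1, 0],
      [- r2, a2 * b2, 0, 0, 0, a2 * d2],
      [0, 0, a1 * r1 + C, - C, 0, 0],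
      [0, 0, - C, a2 * r2 + C, 0, 0],
      [h1 * r1, h1 * (a1 * b1), 0, 0, h1 * (a1 * d1) + a1 * r1 * T1, 0],
      [- (h2 * r2), h2 * (a2 * b2), 0, 0, 0, h2 * (a2 * d2) + a2 * r2 * T2]] ! i ! j)"

definition flux_matrix :: "real \<Rightarrow> real \<Rightarrow> real \<Rightarrow> real \<Rightarrow> real \<Rightarrow> real \<Rightarrow> real mat" where
  "flux_matrix a1 a2 r1 r2 h1 h2 = mat 6 6 (\<lambda>(i, j).
     [[0, 0, a1 * r1, 0, 0, 0],
      [0, 0, 0, a2 * r2, 0, 0],
      [0, a1, 0, 0, 0, 0],
      [0, a2, 0, 0, 0, 0],
      [0, 0, h1 * (a1 * r1), 0, 0, 0],
      [0, 0, 0, h2 * (a2 * r2), 0, 0]] ! i ! j)"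

lemma matrix_carrier [simp]:
  "mass_matrix a1 a2 r1 r2 b1 b2 d1 d2 h1 h2 T1 T2 C \<in> carrier_mat 6 6"
  "flux_matrix a1 a2 r1 r2 h1 h2 \<in> carrier_mat 6 6"
  by (simp_all add: mass_matrix_def flux_matrix_def)

section \<open>The dispersion relation and the spectrum\<close>

text \<open>Dividing the mass equations by the densities and adding them eliminates
  \<open>x\<close>. The momentum equations are a 2 by 2 system for the velocities with determinant
  \<Delta>, solved by Cramer's rule. Substitution leaves a scalar equation times \<open>q\<close>,
  and \<open>q = 0\<close> forces everything else to vanish. A general field is used because the
  lemma is applied over the complex numbers.\<close>

lemma pencil_nontrivial_imp:
  fixes a1 a2 r1 r2 b1 b2 C l :: "'a :: field"
  defines "\<Delta> \<equiv> (a1 * r1) * (a2 * r2) + C * (a1 * r1 + a2 * r2)"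
  assumes nz: "r1 \<noteq> 0" "r2 \<noteq> 0" "\<Delta> \<noteq> 0" "l \<noteq> 0"
    and eqs: "a1 * r1 * u1 = l * (r1 * x + a1 * b1 * q)" "a2 * r2 * u2 = l * (- r2 * x + a2 * b2 * q)"
      "a1 * q = l * ((a1 * r1 + C) * u1 - C * u2)" "a2 * q = l * (- C * u1 + (a2 * r2 + C) * u2)"
  shows "(l\<^sup>2 * \<Delta> * (a1 * b1 / r1 + a2 * b2 / r2) = a1\<^sup>2 * (a2 * r2) + a2\<^sup>2 * (a1 * r1) + C * (a1 + a2)\<^sup>2) \<or>
    (x = 0 \<and> q = 0 \<and> u1 = 0 \<and> u2 = 0)"
proof -
  let ?S = "a1 * b1 / r1 + a2 * b2 / r2"
  have "a1 * u1 = l * x + l * (a1 * b1 / r1) * q" "a2 * u2 = - (l * x) + l * (a2 * b2 / r2) * q"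
    using eqs(1,2) nz by (simp_all add: field_simps)
  then have S: "l * ?S * q = a1 * u1 + a2 * u2"
    by (simp add: algebra_simps)
  have u1: "l * \<Delta> * u1 = ((a2 * r2 + C) * a1 + C * a2) * q"
  proof -
    have "l * \<Delta> * u1 = (a2 * r2 + C) * (l * ((a1 * r1 + C) * u1 - C * u2)) + C * (l * (- C * u1 + (a2 * r2 + C) * u2))"
      by (simp add: \<Delta>_def algebra_simps)
    then show ?thesis
      unfolding eqs(3)[symmetric] eqs(4)[symmetric] by (simp add: algebra_simps)
  qed
  have u2: "l * \<Delta> * u2 = (C * a1 + (a1 * r1 + C) * a2) * q"
  proof -
    have "l * \<Delta> * u2 = C * (l * ((a1 * r1 + C) * u1 - C * u2)) + (a1 * r1 + C) * (l * (- C * u1 + (a2 * r2 + C) * u2))"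
      by (simp add: \<Delta>_def algebra_simps)
    then show ?thesis
      unfolding eqs(3)[symmetric] eqs(4)[symmetric] by (simp add: algebra_simps)
  qed
  have "l\<^sup>2 * \<Delta> * ?S * q = l * \<Delta> * (l * ?S * q)"
    by (simp add: power2_eq_square algebra_simps)
  also have "\<dots> = a1 * (l * \<Delta> * u1) + a2 * (l * \<Delta> * u2)"
    unfolding S by (simp add: algebra_simps)
  also have "\<dots> = (a1\<^sup>2 * (a2 * r2) + a2\<^sup>2 * (a1 * r1) + C * (a1 + a2)\<^sup>2) * q"
    unfolding u1 u2 by (simp add: power2_eq_square algebra_simps)
  finally have "l\<^sup>2 * \<Delta> * ?S = a1\<^sup>2 * (a2 * r2) + a2\<^sup>2 * (a1 * r1) + C * (a1 + a2)\<^sup>2 \<or> q = 0"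
    unfolding mult_cancel_right by blast
  moreover have "x = 0 \<and> u1 = 0 \<and> u2 = 0" if "q = 0"
    using u1 u2 eqs(1) nz that by simp
  ultimately show ?thesis
    by blast
qed

text \<open>With \<open>q\<close> scaled to \<open>l * \<Delta>\<close>, Cramer's formulas give
  \<open>u1\<close> and \<open>u2\<close> without denominators. The first mass equation then defines
  \<open>x\<close>, and the second one amounts to the dispersion relation.\<close>

lemma pencil_solution:
  fixes a1 a2 r1 r2 b1 b2 C l :: "'a :: field"
  defines "\<Delta> \<equiv> (a1 * r1) * (a2 * r2) + C * (a1 * r1 + a2 * r2)"
  assumes nz: "r1 \<noteq> 0" "r2 \<noteq> 0" "\<Delta> \<noteq> 0" "l \<noteq> 0"
    and l: "l\<^sup>2 * \<Delta> * (a1 * b1 / r1 + a2 * b2 / r2) = a1\<^sup>2 * (a2 * r2) + a2\<^sup>2 * (a1 * r1) + C * (a1 + a2)\<^sup>2"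
  obtains x q u1 u2 where "q \<noteq> 0"
    "a1 * r1 * u1 = l * (r1 * x + a1 * b1 * q)" "a2 * r2 * u2 = l * (- r2 * x + a2 * b2 * q)"
    "a1 * q = l * ((a1 * r1 + C) * u1 - C * u2)" "a2 * q = l * (- C * u1 + (a2 * r2 + C) * u2)"
proof -
  define u1 where "u1 = (a2 * r2 + C) * a1 + C * a2"
  define u2 where "u2 = C * a1 + (a1 * r1 + C) * a2"
  define q where "q = l * \<Delta>"
  define x where "x = a1 * u1 / l - a1 * b1 / r1 * q"
  have "a1 * u1 + a2 * u2 = l * (a1 * b1 / r1 + a2 * b2 / r2) * q"
    using l by (simp add: u1_def u2_def q_def power2_eq_square algebra_simps)
  then have "l * (a2 * b2 / r2) * q - l * x = a2 * u2"
    using nz by (simp add: x_def algebra_simps)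
  then have "r2 * (l * (a2 * b2 / r2) * q - l * x) = r2 * (a2 * u2)"
    by simp
  then have "a2 * r2 * u2 = l * (- r2 * x + a2 * b2 * q)"
    using nz by (simp add: algebra_simps)
  moreover have "a1 * r1 * u1 = l * (r1 * x + a1 * b1 * q)"
    using nz by (simp add: x_def field_simps)
  moreover have "a1 * q = l * ((a1 * r1 + C) * u1 - C * u2)" "a2 * q = l * (- C * u1 + (a2 * r2 + C) * u2)"
    by (simp_all add: q_def u1_def u2_def \<Delta>_def algebra_simps)
  moreover have "q \<noteq> 0"
    using nz by (simp add: q_def)
  ultimately show ?thesis
    using that by blast
qed

text \<open>Subtracting the enthalpy multiples of the mass rows from the energy rows kills the
  entropies. The remaining matrix splits into a block for (\<alpha>, p) and one for the velocities,
  both with positive determinant.\<close>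

lemma mass_matrix_kernel:
  assumes pos: "a1 > 0" "a2 > 0" "r1 > 0" "r2 > 0" "b1 > 0" "b2 > 0" "T1 > 0" "T2 > 0" "C \<ge> 0"
    and v: "v \<in> carrier_vec 6" "mass_matrix a1 a2 r1 r2 b1 b2 d1 d2 h1 h2 T1 T2 C *\<^sub>v v = 0\<^sub>v 6"
  shows "v = 0\<^sub>v 6"
proof -
  let ?M = "mass_matrix a1 a2 r1 r2 b1 b2 d1 d2 h1 h2 T1 T2 C"
  have "\<forall>i<6. (?M *\<^sub>v v) $ i = 0"
    using v(2) by simp
  note eqs = this[unfolded all_less_6]
  have 1: "r1 * v $ 0 + a1 * b1 * v $ 1 + a1 * d1 * v $ 4 = 0"
    "- r2 * v $ 0 + a2 * b2 * v $ 1 + a2 * d2 * v $ 5 = 0"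
    "(a1 * r1 + C) * v $ 2 - C * v $ 3 = 0" "- C * v $ 2 + (a2 * r2 + C) * v $ 3 = 0"
    and s: "h1 * r1 * v $ 0 + h1 * (a1 * b1) * v $ 1 + (h1 * (a1 * d1) + a1 * r1 * T1) * v $ 4 = 0"
    "- (h2 * r2) * v $ 0 + h2 * (a2 * b2) * v $ 1 + (h2 * (a2 * d2) + a2 * r2 * T2) * v $ 5 = 0"
    using eqs v(1) by (simp_all add: mult_mat_vec_6 mass_matrix_def del: index_mult_mat_vec)
  have "a1 * r1 * T1 * v $ 4 =
      (h1 * r1 * v $ 0 + h1 * (a1 * b1) * v $ 1 + (h1 * (a1 * d1) + a1 * r1 * T1) * v $ 4)
      - h1 * (r1 * v $ 0 + a1 * b1 * v $ 1 + a1 * d1 * v $ 4)"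
    "a2 * r2 * T2 * v $ 5 =
      (- (h2 * r2) * v $ 0 + h2 * (a2 * b2) * v $ 1 + (h2 * (a2 * d2) + a2 * r2 * T2) * v $ 5)
      - h2 * (- r2 * v $ 0 + a2 * b2 * v $ 1 + a2 * d2 * v $ 5)"
    by (simp_all add: algebra_simps)
  then have s0: "v $ 4 = 0" "v $ 5 = 0"
    using pos unfolding s 1(1,2) by auto
  \<comment> \<open>These multipliers cancel the two contributions of \<open>v $ 0\<close>.\<close>
  have "(a1 * b1 * r2 + a2 * b2 * r1) * v $ 1 =
      r2 * (r1 * v $ 0 + a1 * b1 * v $ 1) + r1 * (- r2 * v $ 0 + a2 * b2 * v $ 1)"
    by (simp add: algebra_simps)
  also have "\<dots> = 0"
    using 1 s0 by simp
  finally have q: "v $ 1 = 0"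
    using pos by (smt (verit) mult_eq_0_iff mult_pos_pos)
  then have x: "v $ 0 = 0"
    using 1(1) s0 pos by simp
  let ?\<Delta> = "(a1 * r1) * (a2 * r2) + C * (a1 * r1 + a2 * r2)"
  have \<Delta>: "?\<Delta> > 0"
    using pos by (intro add_pos_nonneg mult_pos_pos mult_nonneg_nonneg add_nonneg_nonneg) auto
  \<comment> \<open>The rows of the adjugate of the velocity block are applied to the two momentum
    equations.\<close>
  have "?\<Delta> * v $ 2 = (a2 * r2 + C) * ((a1 * r1 + C) * v $ 2 - C * v $ 3) + C * (- C * v $ 2 + (a2 * r2 + C) * v $ 3)"
    "?\<Delta> * v $ 3 = C * ((a1 * r1 + C) * v $ 2 - C * v $ 3) + (a1 * r1 + C) * (- C * v $ 2 + (a2 * r2 + C) * v $ 3)"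
    by (simp_all add: algebra_simps)
  then have "v $ 2 = 0" "v $ 3 = 0"
    using \<Delta> unfolding 1(3,4) by auto
  with q x s0 show ?thesis
    using v(1) by (simp add: vec_6_eq_iff)
qed

lemma spectrum_two_fluid:
  fixes a1 a2 r1 r2 b1 b2 d1 d2 h1 h2 T1 T2 C c :: real
  defines "M \<equiv> mass_matrix a1 a2 r1 r2 b1 b2 d1 d2 h1 h2 T1 T2 C"
    and "N \<equiv> flux_matrix a1 a2 r1 r2 h1 h2"
    and "\<Delta> \<equiv> (a1 * r1) * (a2 * r2) + C * (a1 * r1 + a2 * r2)"
  assumes pos: "a1 > 0" "a2 > 0" "r1 > 0" "r2 > 0" "b1 > 0" "b2 > 0" "T1 > 0" "T2 > 0" "C \<ge> 0" "c > 0"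
    and c: "c\<^sup>2 * \<Delta> * (a1 * b1 / r1 + a2 * b2 / r2) = a1\<^sup>2 * (a2 * r2) + a2\<^sup>2 * (a1 * r1) + C * (a1 + a2)\<^sup>2"
  shows "\<exists>M'\<in>carrier_mat 6 6. inverts_mat M M' \<and> inverts_mat M' M \<and>
    spectrum (map_mat complex_of_real (M' * N)) = complex_of_real ` {-c, 0, c}"
proof -
  have carr: "M \<in> carrier_mat 6 6" "N \<in> carrier_mat 6 6"
    by (simp_all add: M_def N_def)
  obtain M' where M': "M' \<in> carrier_mat 6 6" "M * M' = 1\<^sub>m 6" "M' * M = 1\<^sub>m 6"
    using trivial_kernel_imp_inverse[OF carr(1)] mass_matrix_kernel[OF pos(1-9)] unfolding M_def by metis
  let ?h = "map_mat complex_of_real"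
  have h: "?h M \<in> carrier_mat 6 6" "?h N \<in> carrier_mat 6 6" "?h M' \<in> carrier_mat 6 6"
    using carr M' by auto
  have inv: "?h M * ?h M' = 1\<^sub>m 6" "?h M' * ?h M = 1\<^sub>m 6"
    unfolding of_real_hom.mat_hom_mult[OF carr(1) M'(1), symmetric]
      of_real_hom.mat_hom_mult[OF M'(1) carr(1), symmetric]
    by (simp_all add: M' of_real_hom.mat_hom_one)
  \<comment> \<open>This is the pencil equation with the energy rows reduced to
    \<open>l * v $ 4 = 0\<close> and \<open>l * v $ 5 = 0\<close>. The reduction subtracts the
    enthalpies times the mass rows and divides by the nonzero factors \<open>a1 * r1 * T1\<close>
    and \<open>a2 * r2 * T2\<close>.\<close>
  let ?e = "\<lambda>(l :: complex) (v :: complex vec). a1 * r1 * v $ 2 = l * (r1 * v $ 0 + a1 * b1 * v $ 1 + a1 * d1 * v $ 4) \<and>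
      a2 * r2 * v $ 3 = l * (- r2 * v $ 0 + a2 * b2 * v $ 1 + a2 * d2 * v $ 5) \<and>
      a1 * v $ 1 = l * ((a1 * r1 + C) * v $ 2 - C * v $ 3) \<and>
      a2 * v $ 1 = l * (- C * v $ 2 + (a2 * r2 + C) * v $ 3) \<and>
      l * v $ 4 = 0 \<and> l * v $ 5 = 0"
  have pencil: "?h N *\<^sub>v v = l \<cdot>\<^sub>v (?h M *\<^sub>v v) \<longleftrightarrow> ?e l v" if v: "v \<in> carrier_vec 6" for v :: "complex vec" and l
  proof -
    have "?h N *\<^sub>v v = l \<cdot>\<^sub>v (?h M *\<^sub>v v) \<longleftrightarrow> (\<forall>i<6. (?h N *\<^sub>v v) $ i = l * (?h M *\<^sub>v v) $ i)"
      using h v by (auto simp: vec_eq_iff)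
    also have "\<dots> \<longleftrightarrow> a1 * r1 * v $ 2 = l * (r1 * v $ 0 + a1 * b1 * v $ 1 + a1 * d1 * v $ 4) \<and>
      a2 * r2 * v $ 3 = l * (- r2 * v $ 0 + a2 * b2 * v $ 1 + a2 * d2 * v $ 5) \<and>
      a1 * v $ 1 = l * ((a1 * r1 + C) * v $ 2 - C * v $ 3) \<and>
      a2 * v $ 1 = l * (- C * v $ 2 + (a2 * r2 + C) * v $ 3) \<and>
      h1 * (a1 * r1 * v $ 2) = h1 * (l * (r1 * v $ 0 + a1 * b1 * v $ 1 + a1 * d1 * v $ 4)) + a1 * r1 * T1 * (l * v $ 4) \<and>
      h2 * (a2 * r2 * v $ 3) = h2 * (l * (- r2 * v $ 0 + a2 * b2 * v $ 1 + a2 * d2 * v $ 5)) + a2 * r2 * T2 * (l * v $ 5)"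
      using v carr unfolding all_less_6
      by (simp add: mult_mat_vec_6 h M_def N_def del: index_mult_mat_vec)
        (simp add: mass_matrix_def flux_matrix_def algebra_simps)
    also have "\<dots> \<longleftrightarrow> ?e l v"
      using pos by auto
    finally show ?thesis .
  qed
  have \<Delta>: "\<Delta> > 0"
    unfolding \<Delta>_def using pos by (intro add_pos_nonneg mult_pos_pos mult_nonneg_nonneg add_nonneg_nonneg) auto
  have S: "a1 * b1 / r1 + a2 * b2 / r2 > 0"
    using pos by (intro add_pos_pos divide_pos_pos mult_pos_pos)
  \<comment> \<open>The embedding is pushed down to the parameters so that the two pencil lemmas can
    be instantiated with complex values.\<close>
  let ?\<Delta> = "complex_of_real a1 * complex_of_real r1 * (complex_of_real a2 * complex_of_real r2) +
    complex_of_real C * (complex_of_real a1 * complex_of_real r1 + complex_of_real a2 * complex_of_real r2)"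
  have complex_\<Delta>: "complex_of_real \<Delta> = ?\<Delta>"
    by (simp add: \<Delta>_def)
  then have \<Delta>0: "?\<Delta> \<noteq> 0"
    using \<Delta> by (metis less_irrefl of_real_eq_0_iff)
  have char: "l\<^sup>2 * \<Delta> * (a1 * b1 / r1 + a2 * b2 / r2) = a1\<^sup>2 * (a2 * r2) + a2\<^sup>2 * (a1 * r1) + C * (a1 + a2)\<^sup>2
      \<longleftrightarrow> l = - c \<or> l = c" for l :: complex
  proof -
    have "complex_of_real (a1\<^sup>2 * (a2 * r2) + a2\<^sup>2 * (a1 * r1) + C * (a1 + a2)\<^sup>2) =
        complex_of_real (c\<^sup>2 * \<Delta> * (a1 * b1 / r1 + a2 * b2 / r2))"
      using c by simp
    then have "l\<^sup>2 * \<Delta> * (a1 * b1 / r1 + a2 * b2 / r2) = a1\<^sup>2 * (a2 * r2) + a2\<^sup>2 * (a1 * r1) + C * (a1 + a2)\<^sup>2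
      \<longleftrightarrow> l\<^sup>2 * complex_of_real (\<Delta> * (a1 * b1 / r1 + a2 * b2 / r2)) =
        (complex_of_real c)\<^sup>2 * complex_of_real (\<Delta> * (a1 * b1 / r1 + a2 * b2 / r2))"
      by (simp add: mult.assoc)
    also have "\<dots> \<longleftrightarrow> l\<^sup>2 = (complex_of_real c)\<^sup>2"
      using \<Delta> S by (simp del: of_real_mult of_real_add of_real_divide)
    finally show ?thesis
      by (auto simp: power2_eq_iff)
  qed
  have "eigenvalue (?h (M' * N)) l \<longleftrightarrow> l \<in> complex_of_real ` {-c, 0, c}" for l
  proof -
    have "eigenvalue (?h (M' * N)) l \<longleftrightarrow> (\<exists>v\<in>carrier_vec 6. v \<noteq> 0\<^sub>v 6 \<and> ?e l v)"
      unfolding of_real_hom.mat_hom_mult[OF M'(1) carr(2)]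
        eigenvalue_inverse_mult_iff[OF h inv] by (simp add: pencil cong: bex_cong conj_cong)
    also have "\<dots> \<longleftrightarrow> l = 0 \<or> l = - c \<or> l = c"
    proof
      assume "\<exists>v\<in>carrier_vec 6. v \<noteq> 0\<^sub>v 6 \<and> ?e l v"
      then obtain v where v: "v \<in> carrier_vec 6" "v \<noteq> 0\<^sub>v 6" "?e l v"
        by blast
      show "l = 0 \<or> l = - c \<or> l = c"
      proof (cases "l = 0")
        case False
        then have "v $ 4 = 0" "v $ 5 = 0"
          using v(3) by auto
        moreover from this v have "\<not> (v $ 0 = 0 \<and> v $ 1 = 0 \<and> v $ 2 = 0 \<and> v $ 3 = 0)"
          by (simp add: vec_6_eq_iff)
        ultimately show ?thesis
          using pencil_nontrivial_imp[of "complex_of_real r1" "complex_of_real r2" a1 a2 C l "v $ 2" "v $ 0" b1 "v $ 1" "v $ 3" b2]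
            v(3) pos \<Delta>0 False char[of l] by (auto simp: complex_\<Delta>)
      qed simp
    next
      assume l: "l = 0 \<or> l = - c \<or> l = c"
      show "\<exists>v\<in>carrier_vec 6. v \<noteq> 0\<^sub>v 6 \<and> ?e l v"
      proof (cases "l = 0")
        \<comment> \<open>For \<open>l = 0\<close> the equations involve only \<open>v $ 1\<close>,
          \<open>v $ 2\<close> and \<open>v $ 3\<close>, so a perturbation of the volume fraction
          alone is a solution.\<close>
        case True
        then show ?thesis
          by (intro bexI[of _ "unit_vec 6 0"]) (auto simp: vec_6_eq_iff)
      next
        case False
        with l char[of l] have "l\<^sup>2 * ?\<Delta> * (complex_of_real a1 * complex_of_real b1 / complex_of_real r1
            + complex_of_real a2 * complex_of_real b2 / complex_of_real r2) =
          (complex_of_real a1)\<^sup>2 * (complex_of_real a2 * complex_of_real r2)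
            + (complex_of_real a2)\<^sup>2 * (complex_of_real a1 * complex_of_real r1)
            + complex_of_real C * (complex_of_real a1 + complex_of_real a2)\<^sup>2"
          by (simp add: complex_\<Delta>)
        from pencil_solution[OF _ _ \<Delta>0 False this] pos obtain x q u1 u2 :: complex where sol: "q \<noteq> 0"
          "complex_of_real a1 * complex_of_real r1 * u1 =
            l * (complex_of_real r1 * x + complex_of_real a1 * complex_of_real b1 * q)"
          "complex_of_real a2 * complex_of_real r2 * u2 =
            l * (- complex_of_real r2 * x + complex_of_real a2 * complex_of_real b2 * q)"
          "complex_of_real a1 * q =
            l * ((complex_of_real a1 * complex_of_real r1 + complex_of_real C) * u1 - complex_of_real C * u2)"
          "complex_of_real a2 * q =
            l * (- complex_of_real C * u1 + (complex_of_real a2 * complex_of_real r2 + complex_of_real C) * u2)"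
          by (metis of_real_eq_0_iff less_irrefl)
        let ?v = "vec_of_list [x, q, u1, u2, 0, 0]"
        have "?v \<in> carrier_vec 6"
          by (simp add: carrier_vecI)
        moreover have "?v \<noteq> 0\<^sub>v 6"
        proof
          assume "?v = 0\<^sub>v 6"
          from arg_cong[OF this, of "\<lambda>v. v $ 1"] show False
            unfolding vec_of_list_6_index using sol(1) by simp
        qed
        moreover have "?e l ?v"
          unfolding vec_of_list_6_index using sol by simp
        ultimately show ?thesis
          by blast
      qed
    qed
    finally show ?thesis
      by auto
  qed
  then have "spectrum (?h (M' * N)) = complex_of_real ` {-c, 0, c}"
    by (auto simp: spectrum_def)
  with M' carr show ?thesis
    by (auto simp: inverts_mat_def)
qed


section \<open>Linearization of the full two-fluid system\<close>

text \<open>The relative acceleration in the force vanishes at \<epsilon> = 0. Its coefficient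
  therefore enters only through its value \<open>C\<close> at the constant state, and continuity of
  \<kappa> is enough.\<close>

lemma two_fluid_linearization:
  fixes \<kappa> :: "real \<times> real \<times> real \<times> real \<Rightarrow> real"
  assumes eos: "equation_of_state Dp ep" "equation_of_state Dm em"
    and law: "density_law Dp ep Qp Rp" "density_law Dm em Qm Rm"
    and \<kappa>: "isCont \<kappa> (p, sp, sm, a)"
    and Q: "(p, sp) \<in> Qp" "(p, sm) \<in> Qm"
    and r: "rp = Rp (p, sp)" "rm = Rm (p, sm)" "rp \<noteq> 0" "rm \<noteq> 0" "a * rp + (1 - a) * rm \<noteq> 0"
    and C: "C = \<kappa> (p, sp, sm, a) * (a * (1 - a) * rp * rm / (a * rp + (1 - a) * rm))"
  shows "is_linearization 6 (two_fluid_residual ep em Rp Rm \<kappa>) (vec_of_list [a, p, 0, 0, sp, sm])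
    (mass_matrix a (1 - a) rp rm (1 / sound_speed_sq ep (rp, sp)) (1 / sound_speed_sq em (rm, sm))
      (pd2 Rp (p, sp)) (pd2 Rm (p, sm)) (ep (rp, sp) + p / rp) (em (rm, sm) + p / rm)
      (temperature ep (rp, sp)) (temperature em (rm, sm)) C)
    (flux_matrix a (1 - a) rp rm (ep (rp, sp) + p / rp) (em (rm, sm) + p / rm))"
    (is "is_linearization 6 ?F ?W0 ?M ?N")
  unfolding is_linearization_def
proof (intro conjI allI impI)
  fix w z i assume w: "smooth_field 6 w" and "i < (6::nat)"
  have "w y \<in> carrier_vec 6" for y
    using w unfolding smooth_field_def by blast
  then have comp: "(?W0 + \<epsilon> \<cdot>\<^sub>v w y) $ i = ?W0 $ i + \<epsilon> * w y $ i" if "i < 6" for i y \<epsilon>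
    using that by (metis carrier_vecD index_add_vec(1) index_smult_vec)
  \<comment> \<open>The velocities keep a leading \<open>0 +\<close> so that all six components have
    the form required by \<open>expansion_affine\<close>.\<close>
  have field: "(?W0 + \<epsilon> \<cdot>\<^sub>v w y) $ 0 = a + \<epsilon> * w y $ 0" "(?W0 + \<epsilon> \<cdot>\<^sub>v w y) $ 1 = p + \<epsilon> * w y $ 1"
    "(?W0 + \<epsilon> \<cdot>\<^sub>v w y) $ 2 = 0 + \<epsilon> * w y $ 2" "(?W0 + \<epsilon> \<cdot>\<^sub>v w y) $ 3 = 0 + \<epsilon> * w y $ 3"
    "(?W0 + \<epsilon> \<cdot>\<^sub>v w y) $ 4 = sp + \<epsilon> * w y $ 4" "(?W0 + \<epsilon> \<cdot>\<^sub>v w y) $ 5 = sm + \<epsilon> * w y $ 5" for y \<epsilon>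
    by (simp_all add: comp vec_of_list_6_index del: vec_of_list_Cons One_nat_def)
  have X: "expansion (\<lambda>\<epsilon> y. c + \<epsilon> * w y $ i) z c (pd1 (\<lambda>y. w y $ i) z) (pd2 (\<lambda>y. w y $ i) z)"
    if "i < 6" for c i
  proof (rule expansion_affine)
    have "smooth_on UNIV (\<lambda>y. w y $ i)"
      using w that by (simp add: smooth_field_def)
    then show "(\<lambda>y. w y $ i) differentiable (at z)"
      using C1_on_has_derivative[OF smooth_on_imp_C1_on] differentiableI by blast
  qed
  let ?a = "\<lambda>\<epsilon> y. a + \<epsilon> * w y $ 0" and ?p = "\<lambda>\<epsilon> y. p + \<epsilon> * w y $ 1"
    and ?up = "\<lambda>\<epsilon> y. 0 + \<epsilon> * w y $ 2" and ?um = "\<lambda>\<epsilon> y. 0 + \<epsilon> * w y $ 3"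
    and ?sp = "\<lambda>\<epsilon> y. sp + \<epsilon> * w y $ 4" and ?sm = "\<lambda>\<epsilon> y. sm + \<epsilon> * w y $ 5"
  let ?w1 = "\<lambda>i. pd1 (\<lambda>y. w y $ i) z" and ?w2 = "\<lambda>i. pd2 (\<lambda>y. w y $ i) z"
  have exp: "expansion ?a z a (?w1 0) (?w2 0)" "expansion ?p z p (?w1 1) (?w2 1)"
    "expansion ?up z 0 (?w1 2) (?w2 2)" "expansion ?um z 0 (?w1 3) (?w2 3)"
    "expansion ?sp z sp (?w1 4) (?w2 4)" "expansion ?sm z sm (?w1 5) (?w2 5)"
    by (rule X; simp)+
  have exp_m: "expansion (\<lambda>\<epsilon> y. 1 - ?a \<epsilon> y) z (1 - a) (- ?w1 0) (- ?w2 0)"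
    using expansion_diff[OF expansion_const[of 1] exp(1)] by simp
  note fp = fluid_derivatives[OF eos(1) law(1) Q(1) r(1,3) exp(1,2,3,5)]
    and fm = fluid_derivatives[OF eos(2) law(2) Q(2) r(2,4) exp_m exp(2,4,6)]
  let ?rp = "\<lambda>\<epsilon> y. Rp (?p \<epsilon> y, ?sp \<epsilon> y)" and ?rm = "\<lambda>\<epsilon> y. Rm (?p \<epsilon> y, ?sm \<epsilon> y)"
  let ?G = "\<lambda>\<epsilon> y. \<kappa> (?p \<epsilon> y, ?sp \<epsilon> y, ?sm \<epsilon> y, ?a \<epsilon> y) *
    (?a \<epsilon> y * (1 - ?a \<epsilon> y) * ?rp \<epsilon> y * ?rm \<epsilon> y / (?a \<epsilon> y * ?rp \<epsilon> y + (1 - ?a \<epsilon> y) * ?rm \<epsilon> y))"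
  let ?g = "\<lambda>\<epsilon> y. ?G \<epsilon> y * pd1 (\<lambda>y'. ?up \<epsilon> y' - ?um \<epsilon> y') y"
  have "isCont (\<lambda>\<epsilon>. \<kappa> (?p \<epsilon> z, ?sp \<epsilon> z, ?sm \<epsilon> z, ?a \<epsilon> z)) 0"
  proof (rule isCont_o2[where g = \<kappa>])
    show "isCont (\<lambda>\<epsilon>. (?p \<epsilon> z, ?sp \<epsilon> z, ?sm \<epsilon> z, ?a \<epsilon> z)) 0"
      by (intro continuous_Pair expansion_isCont(1)[OF exp(1)] expansion_isCont(1)[OF exp(2)]
          expansion_isCont(1)[OF exp(5)] expansion_isCont(1)[OF exp(6)])
  qed (use \<kappa> in simp)
  moreover have "isCont (\<lambda>\<epsilon>. ?rp \<epsilon> z) 0" "isCont (\<lambda>\<epsilon>. ?rm \<epsilon> z) 0"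
    by (rule expansion_isCont[OF fp(4)] expansion_isCont[OF fm(4)])+
  ultimately have G: "isCont (\<lambda>\<epsilon>. ?G \<epsilon> z) 0"
    using r by (intro isCont_mult isCont_divide isCont_add isCont_diff continuous_const expansion_isCont(1)[OF exp(1)]) auto
  note du = expansion_pd[OF expansion_diff[OF exp(3,4)]]
  \<comment> \<open>The factor vanishing at \<epsilon> = 0 is placed first, to match
    \<open>DERIV_mult_isCont\<close>.\<close>
  have "((\<lambda>\<epsilon>. pd1 (\<lambda>y'. ?up \<epsilon> y' - ?um \<epsilon> y') z * ?G \<epsilon> z) has_real_derivative (?w1 2 - ?w1 3) * ?G 0 z) (at 0)"
    by (rule DERIV_mult_isCont[OF du(1,2) G])
  then have gm: "((\<lambda>\<epsilon>. ?g \<epsilon> z) has_real_derivative C * (?w1 2 - ?w1 3)) (at 0)"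
    by (simp add: r C mult.commute)
  then have gp: "((\<lambda>\<epsilon>. - ?g \<epsilon> z) has_real_derivative - (C * (?w1 2 - ?w1 3))) (at 0)"
    by (rule DERIV_minus)
  have g0: "?g 0 z = 0" "- ?g 0 z = 0"
    using du(2) by simp_all
  note F = fp(1) fm(1) fp(2)[where f = "\<lambda>\<epsilon> y. - ?g \<epsilon> y", OF gp] fm(2)[where f = ?g, OF gm]
    fp(3)[where f = "\<lambda>\<epsilon> y. - ?g \<epsilon> y", OF gp g0(2)] fm(3)[where f = ?g, OF gm g0(1)]
  let ?v = "vec 6 ?w1" and ?v' = "vec 6 ?w2"
  have "\<forall>i<6. ((\<lambda>\<epsilon>. ?F (\<lambda>y. ?W0 + \<epsilon> \<cdot>\<^sub>v w y) z $ i) has_real_derivative (?M *\<^sub>v ?v + ?N *\<^sub>v ?v') $ i) (at 0)"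
    unfolding all_less_6 two_fluid_residual_def Let_def vec_of_list_6_index field
    by (intro conjI; (rule DERIV_cong[OF F(1)] DERIV_cong[OF F(2)] DERIV_cong[OF F(3)] DERIV_cong[OF F(4)] DERIV_cong[OF F(5)] DERIV_cong[OF F(6)],
      simp add: mult_mat_vec_6 mass_matrix_def flux_matrix_def algebra_simps
        add_divide_distrib diff_divide_distrib del: index_mult_mat_vec))
  with \<open>i < 6\<close> show "((\<lambda>\<epsilon>. ?F (\<lambda>y. ?W0 + \<epsilon> \<cdot>\<^sub>v w y) z $ i) has_real_derivative (?M *\<^sub>v ?v + ?N *\<^sub>v ?v') $ i) (at 0)"
    by blast
qed simp_all


subsection \<open>The sound speed\<close>

text \<open>Here \<open>c1\<close> and \<open>c2\<close> stand for the squared sound speeds. By the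
  choice of \<open>C\<close>, the determinant equals \<open>a1 * r1 * (a2 * r2) * (1 + k)\<close>,
  and this \<open>1 + k\<close> cancels the one in the denominators of the first factor. The factor
  with the sound speeds is the reciprocal of the compressibility sum that ends the left-hand
  side.\<close>

lemma added_mass_speed_identity:
  fixes a1 a2 r1 r2 c1 c2 k r C :: real
  assumes pos: "a1 > 0" "a2 > 0" "r1 > 0" "r2 > 0" "c1 > 0" "c2 > 0" "k \<ge> 0" and a: "a1 + a2 = 1"
    and r: "r = a1 * r1 + a2 * r2" and C: "C = k * (a1 * a2 * r1 * r2 / r)"
  shows "(a1 * ((r + k * r1) / (r * (1 + k) * r1)) + a2 * ((r + k * r2) / (r * (1 + k) * r2)))
      * (r1 * r2 * c1 * c2 / (a1 * r2 * c2 + a2 * r1 * c1))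
      * ((a1 * r1) * (a2 * r2) + C * (a1 * r1 + a2 * r2)) * (a1 * (1 / c1) / r1 + a2 * (1 / c2) / r2)
    = a1\<^sup>2 * (a2 * r2) + a2\<^sup>2 * (a1 * r1) + C * (a1 + a2)\<^sup>2"
proof -
  define X where "X = a1 * ((r + k * r1) / (r * (1 + k) * r1)) + a2 * ((r + k * r2) / (r * (1 + k) * r2))"
  have r0: "r > 0"
    using pos r by (simp add: add_pos_pos)
  have k0: "1 + k > 0"
    using pos by simp
  \<comment> \<open>This splitting isolates \<open>k / r\<close>, whose weights \<open>a1\<close>
    and \<open>a2\<close> sum to 1.\<close>
  have frac: "(r + k * s) / (r * (1 + k) * s) = (1 / s + k / r) / (1 + k)" if "s > 0" for s
    using that r0 k0 by (simp add: divide_simps)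
  have "X = (a1 * (1 / r1 + k / r) + a2 * (1 / r2 + k / r)) / (1 + k)"
    unfolding X_def frac[OF pos(3)] frac[OF pos(4)]
    by (simp only: times_divide_eq_right flip: add_divide_distrib)
  then have "X * (1 + k) = a1 * (1 / r1 + k / r) + a2 * (1 / r2 + k / r)"
    using k0 by simp
  also have "\<dots> = a1 / r1 + a2 / r2 + (a1 + a2) * (k / r)"
    by (simp add: algebra_simps add_divide_distrib)
  finally have X: "X * (1 + k) = a1 / r1 + a2 / r2 + k / r"
    by (simp add: a)
  have "(a1 * r1) * (a2 * r2) + C * (a1 * r1 + a2 * r2) = (a1 * r1) * (a2 * r2) * (1 + k)"
    using r0 unfolding r[symmetric] C by (simp add: algebra_simps)
  then have "X * ((a1 * r1) * (a2 * r2) + C * (a1 * r1 + a2 * r2)) = (a1 * r1) * (a2 * r2) * (X * (1 + k))"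
    by simp
  also have "\<dots> = a1\<^sup>2 * (a2 * r2) + a2\<^sup>2 * (a1 * r1) + C"
    unfolding X C using pos by (simp add: distrib_left power2_eq_square)
  finally have \<Delta>: "X * ((a1 * r1) * (a2 * r2) + C * (a1 * r1 + a2 * r2)) = a1\<^sup>2 * (a2 * r2) + a2\<^sup>2 * (a1 * r1) + C" .
  have "a1 * (1 / c1) / r1 + a2 * (1 / c2) / r2 = (a1 * r2 * c2 + a2 * r1 * c1) / (r1 * r2 * c1 * c2)"
    using pos by (simp add: field_simps)
  moreover have "a1 * r2 * c2 + a2 * r1 * c1 > 0"
    using pos by (simp add: add_pos_pos)
  ultimately have "r1 * r2 * c1 * c2 / (a1 * r2 * c2 + a2 * r1 * c1) * (a1 * (1 / c1) / r1 + a2 * (1 / c2) / r2) = 1"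
    using pos by simp
  moreover have "x * y * d * s = x * d" if "y * s = 1" for x y d s :: real
    using arg_cong[OF that, of "\<lambda>t. x * d * t"] by (simp add: ac_simps)
  ultimately show ?thesis
    unfolding X_def[symmetric] using \<Delta> by (simp only: a power_one mult_1_right)
qed

text \<open>Existence of a linearization is asserted next to the claim about all of them, so that
  this claim is not vacuous. The matrices are taken over the complex numbers, so non-real
  eigenvalues are excluded as well.\<close>

theorem mainTheorem3:
  fixes Dp Dm Qp Qm :: "(real \<times> real) set"
    and ep em Rp Rm :: "real \<times> real \<Rightarrow> real"
    and \<kappa> :: "real \<times> real \<times> real \<times> real \<Rightarrow> real"
    and p sp sm \<alpha>p \<alpha>m \<rho>p \<rho>m cp cm \<rho> k :: real
  assumes "equation_of_state Dp ep" and "equation_of_state Dm em"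
    and "density_law Dp ep Qp Rp" and "density_law Dm em Qm Rm"
    and "continuous_on {(p, sp, sm, a). (p, sp) \<in> Qp \<and> (p, sm) \<in> Qm \<and> 0 < a \<and> a < 1} \<kappa>"
    and "\<And>p sp sm a. (p, sp) \<in> Qp \<Longrightarrow> (p, sm) \<in> Qm \<Longrightarrow> 0 < a \<Longrightarrow> a < 1 \<Longrightarrow> 0 \<le> \<kappa> (p, sp, sm, a)"
    and "0 < \<alpha>p" and "\<alpha>p < 1" and "\<alpha>m = 1 - \<alpha>p"
    and "(p, sp) \<in> Qp" and "(p, sm) \<in> Qm"
    and "\<rho>p = Rp (p, sp)" and "\<rho>m = Rm (p, sm)" and "\<rho>p > 0" and "\<rho>m > 0"
    and "cp > 0" and "cp\<^sup>2 = sound_speed_sq ep (\<rho>p, sp)"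
    and "cm > 0" and "cm\<^sup>2 = sound_speed_sq em (\<rho>m, sm)"
    and "\<rho> = \<alpha>p * \<rho>p + \<alpha>m * \<rho>m" and "k = \<kappa> (p, sp, sm, \<alpha>p)"
  shows "\<exists>c>0.
      c\<^sup>2 = (\<alpha>p * ((\<rho> + k * \<rho>p) / (\<rho> * (1 + k) * \<rho>p)) + \<alpha>m * ((\<rho> + k * \<rho>m) / (\<rho> * (1 + k) * \<rho>m)))
            * (\<rho>p * \<rho>m * cp\<^sup>2 * cm\<^sup>2 / (\<alpha>p * \<rho>m * cm\<^sup>2 + \<alpha>m * \<rho>p * cp\<^sup>2)) \<and>
      (\<exists>M N. is_linearization 6 (two_fluid_residual ep em Rp Rm \<kappa>)
               (vec_of_list [\<alpha>p, p, 0, 0, sp, sm]) M N) \<and>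
      (\<forall>M N. is_linearization 6 (two_fluid_residual ep em Rp Rm \<kappa>)
               (vec_of_list [\<alpha>p, p, 0, 0, sp, sm]) M N \<longrightarrow>
         (\<exists>M'\<in>carrier_mat 6 6. inverts_mat M M' \<and> inverts_mat M' M \<and>
            spectrum (map_mat complex_of_real (M' * N)) = complex_of_real ` {-c, 0, c}))"
proof -
  define C where "C = k * (\<alpha>p * \<alpha>m * \<rho>p * \<rho>m / \<rho>)"
  let ?c2 = "(\<alpha>p * ((\<rho> + k * \<rho>p) / (\<rho> * (1 + k) * \<rho>p)) + \<alpha>m * ((\<rho> + k * \<rho>m) / (\<rho> * (1 + k) * \<rho>m)))
            * (\<rho>p * \<rho>m * cp\<^sup>2 * cm\<^sup>2 / (\<alpha>p * \<rho>m * cm\<^sup>2 + \<alpha>m * \<rho>p * cp\<^sup>2))"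
  have k: "k \<ge> 0"
    using assms(6)[OF assms(10,11,7,8)] assms(21) by simp
  have pos: "\<alpha>p > 0" "\<alpha>m > 0" "\<rho>p > 0" "\<rho>m > 0" "cp\<^sup>2 > 0" "cm\<^sup>2 > 0" "\<rho> > 0"
    using assms(7-9,14-16,18,20) by (simp_all add: add_pos_pos)
  have T: "temperature ep (\<rho>p, sp) > 0" "temperature em (\<rho>m, sm) > 0"
    using assms(1-4,10-13) unfolding equation_of_state_def density_law_def by blast+
  have C0: "C \<ge> 0"
    unfolding C_def using k pos by simp
  have c2: "?c2 > 0"
    using pos k by (intro mult_pos_pos divide_pos_pos add_pos_pos add_pos_nonneg mult_nonneg_nonneg) auto
  define c where "c = sqrt ?c2"
  have c: "c > 0" "c\<^sup>2 = ?c2"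
    unfolding c_def using c2 by (simp_all only: real_sqrt_gt_zero real_sqrt_pow2 less_imp_le)
  \<comment> \<open>The domain of \<kappa> is shown to be open, which turns continuity on it into
    continuity at the constant state.\<close>
  let ?K = "{(p, sp, sm, a :: real). (p, sp) \<in> Qp \<and> (p, sm) \<in> Qm \<and> 0 < a \<and> a < 1}"
  have "?K = (\<lambda>x. (fst x, fst (snd x))) -` Qp \<inter> (\<lambda>x. (fst x, fst (snd (snd x)))) -` Qm
      \<inter> (\<lambda>x. snd (snd (snd x))) -` {0<..<1}"
    by auto
  moreover have "open \<dots>"
    using assms(3,4) unfolding density_law_def
    by (intro open_Int open_vimage open_greaterThanLessThan continuous_intros) auto
  ultimately have "open ?K"
    by simp
  moreover have "(p, sp, sm, \<alpha>p) \<in> ?K"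
    using assms(7,8,10,11) by simp
  ultimately have \<kappa>: "isCont \<kappa> (p, sp, sm, \<alpha>p)"
    using assms(5) by (simp only: continuous_on_eq_continuous_at)
  let ?M = "mass_matrix \<alpha>p \<alpha>m \<rho>p \<rho>m (1 / cp\<^sup>2) (1 / cm\<^sup>2) (pd2 Rp (p, sp)) (pd2 Rm (p, sm))
    (ep (\<rho>p, sp) + p / \<rho>p) (em (\<rho>m, sm) + p / \<rho>m) (temperature ep (\<rho>p, sp)) (temperature em (\<rho>m, sm)) C"
  let ?N = "flux_matrix \<alpha>p \<alpha>m \<rho>p \<rho>m (ep (\<rho>p, sp) + p / \<rho>p) (em (\<rho>m, sm) + p / \<rho>m)"
  let ?lin = "is_linearization 6 (two_fluid_residual ep em Rp Rm \<kappa>) (vec_of_list [\<alpha>p, p, 0, 0, sp, sm])"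
  have lin: "?lin ?M ?N"
    unfolding assms(9,17,19)
    by (rule two_fluid_linearization[OF assms(1-4) \<kappa> assms(10-13)])
      (use pos assms(9,20,21) C_def in auto)
  have "c\<^sup>2 * (\<alpha>p * \<rho>p * (\<alpha>m * \<rho>m) + C * (\<alpha>p * \<rho>p + \<alpha>m * \<rho>m)) * (\<alpha>p * (1 / cp\<^sup>2) / \<rho>p + \<alpha>m * (1 / cm\<^sup>2) / \<rho>m)
      = \<alpha>p\<^sup>2 * (\<alpha>m * \<rho>m) + \<alpha>m\<^sup>2 * (\<alpha>p * \<rho>p) + C * (\<alpha>p + \<alpha>m)\<^sup>2"
    unfolding c(2) using assms(9) by (intro added_mass_speed_identity pos k assms(20) C_def) simp
  then have spec: "\<exists>M'\<in>carrier_mat 6 6. inverts_mat ?M M' \<and> inverts_mat M' ?M \<and>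
      spectrum (map_mat complex_of_real (M' * ?N)) = complex_of_real ` {-c, 0, c}"
    using pos T C0 c(1) by (intro spectrum_two_fluid) auto
  \<comment> \<open>By uniqueness, any linearization is the explicit pair whose spectrum is
    known.\<close>
  have "\<exists>M'\<in>carrier_mat 6 6. inverts_mat M M' \<and> inverts_mat M' M \<and>
      spectrum (map_mat complex_of_real (M' * N)) = complex_of_real ` {-c, 0, c}" if "?lin M N" for M N
    unfolding is_linearization_unique[OF that lin] by (rule spec)
  with c lin show ?thesis
    by blast
qed

end
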